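(* For $1<s<\infty$ let $s'$ denote the conjugate exponent of $s$ (that is, $\frac1s+\frac1{s'}=1$). (a) If $2<p,q<\infty$, then $(\ell_p,\ell_q;\mathbb{K})$ has property $\mathbf{L}_{p,p}$ (for bilinear forms). (b) If $1<p,q<\infty$, then $(\ell_p,\ell_q;\mathbb{K})$ has property $\mathbf{L}_{o,o}$ (for bilinear forms) if and only if $pq>p+q$ (equivalently, $p>q'$).
   Context: $\mathbb{K}$ is $\mathbb{R}$ or $\mathbb{C}$; $\ell_p$ is the usual space of $p$-summable scalar sequences over $\mathbb{K}$. $S_X$ is the unit sphere of a Banach space $X$. $\mathcal{L}(X_1,X_2;\mathbb{K})$ is the space of bounded bilinear forms on $X_1\times X_2$ with $\|A\|=\sup\{|A(x_1,x_2)|: x_i\in S_{X_i}\}$. $(X_1,X_2;\mathbb{K})$ has property $\mathbf{L}_{p,p}$ if for every $\varepsilon>0$ and every $(x_1,x_2)\in S_{X_1}\times S_{X_2}$ there is $\eta=\eta(\varepsilon,(x_1,x_2))>0$ such that whenever $A\in\mathcal{L}(X_1,X_2;\mathbb{K})$ satisfies $\|A\|=1$ and $|A(x_1,x_2)|>1-\eta$, there is $B\in\mathcal{L}(X_1,X_2;\mathbb{K})$ with $\|B\|=1$, $|B(x_1,x_2)|=1$ and $\|B-A\|<\varepsilon$. (The subscripts $p,p$ in $\mathbf{L}_{p,p}$ stand for "point" and are unrelated to the exponent $p$.) $(X_1,X_2;\mathbb{K})$ has property $\mathbf{L}_{o,o}$ if for every $\varepsilon>0$ and every $A\in\mathcal{L}(X_1,X_2;\mathbb{K})$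 with $\|A\|=1$ there is $\eta=\eta(\varepsilon,A)>0$ such that whenever $(x_1,x_2)\in S_{X_1}\times S_{X_2}$ satisfies $|A(x_1,x_2)|>1-\eta$, there is $(z_1,z_2)\in S_{X_1}\times S_{X_2}$ with $|A(z_1,z_2)|=1$ and $\max_{j}\|x_j-z_j\|<\varepsilon$. *)

theory Defs
  imports "HOL-Analysis.Analysis"
begin

text \<open>
  The spaces $\ell_p$ for varying real \<open>p\<close> are not types, so a normed space of scalar sequences is
  represented by its carrier and its norm. The linear structure is always the pointwise one.
  The scalar field \<open>'k\<close> is meant to be instantiated by \<^typ>\<open>real\<close> and \<^typ>\<open>complex\<close>.
\<close>

record 'k seq_space =
  carr :: "(nat \<Rightarrow> 'k) set"
  nrm  :: "(nat \<Rightarrow> 'k) \<Rightarrow> real"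

definition lp :: "real \<Rightarrow> 'k::real_normed_field seq_space" where
  "lp p = \<lparr> carr = {x. summable (\<lambda>n. norm (x n) powr p)},
            nrm = (\<lambda>x. (\<Sum>n. norm (x n) powr p) powr (1 / p)) \<rparr>"

definition usphere :: "'k seq_space \<Rightarrow> (nat \<Rightarrow> 'k) set" where
  "usphere X = {x \<in> carr X. nrm X x = 1}"

type_synonym 'k form2 = "(nat \<Rightarrow> 'k) \<Rightarrow> (nat \<Rightarrow> 'k) \<Rightarrow> 'k"

text \<open>
  Forms are total functions on pairs of sequences, constrained only on the carriers; nothing below
  depends on their values elsewhere.
\<close>

definition bounded_bilinear_forms ::
    "'k::real_normed_field seq_space \<Rightarrow> 'k seq_space \<Rightarrow> 'k form2 set" where
  "bounded_bilinear_forms X Y = {A.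
     (\<forall>x\<in>carr X. \<forall>x'\<in>carr X. \<forall>y\<in>carr Y. A (\<lambda>n. x n + x' n) y = A x y + A x' y) \<and>
     (\<forall>x\<in>carr X. \<forall>y\<in>carr Y. \<forall>y'\<in>carr Y. A x (\<lambda>n. y n + y' n) = A x y + A x y') \<and>
     (\<forall>c. \<forall>x\<in>carr X. \<forall>y\<in>carr Y. A (\<lambda>n. c * x n) y = c * A x y) \<and>
     (\<forall>c. \<forall>x\<in>carr X. \<forall>y\<in>carr Y. A x (\<lambda>n. c * y n) = c * A x y) \<and>
     (\<exists>C. \<forall>x\<in>carr X. \<forall>y\<in>carr Y. norm (A x y) \<le> C * nrm X x * nrm Y y)}"

definition form_norm ::
    "'k::real_normed_field seq_space \<Rightarrow> 'k seq_space \<Rightarrow> 'k form2 \<Rightarrow> real" where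
  "form_norm X Y A = Sup {norm (A x y) | x y. x \<in> usphere X \<and> y \<in> usphere Y}"

text \<open>The subscripts \<open>pp\<close> (``point'') and \<open>oo\<close> (``operator'') are unrelated to any exponent.\<close>

definition property_L_pp :: "'k::real_normed_field seq_space \<Rightarrow> 'k seq_space \<Rightarrow> bool" where
  "property_L_pp X Y \<longleftrightarrow>
     (\<forall>\<epsilon>>0. \<forall>x\<in>usphere X. \<forall>y\<in>usphere Y. \<exists>\<eta>>0.
        \<forall>A\<in>bounded_bilinear_forms X Y.
          form_norm X Y A = 1 \<and> norm (A x y) > 1 - \<eta> \<longrightarrow>
          (\<exists>B\<in>bounded_bilinear_forms X Y.
             form_norm X Y B = 1 \<and> norm (B x y) = 1 \<and>
             form_norm X Y (\<lambda>u v. B u v - A u v) < \<epsilon>))"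

definition property_L_oo :: "'k::real_normed_field seq_space \<Rightarrow> 'k seq_space \<Rightarrow> bool" where
  "property_L_oo X Y \<longleftrightarrow>
     (\<forall>\<epsilon>>0. \<forall>A\<in>bounded_bilinear_forms X Y. form_norm X Y A = 1 \<longrightarrow>
        (\<exists>\<eta>>0. \<forall>x\<in>usphere X. \<forall>y\<in>usphere Y.
          norm (A x y) > 1 - \<eta> \<longrightarrow>
          (\<exists>z\<in>usphere X. \<exists>w\<in>usphere Y.
             norm (A z w) = 1 \<and>
             max (nrm X (\<lambda>n. x n - z n)) (nrm Y (\<lambda>n. y n - w n)) < \<epsilon>)))"

end

theory Submission
  imports Defs "HOL-Complex_Analysis.Great_Picard"
begin

text \<open>
  For \<open>(a)\<close>, let \<open>\<bar>A x y\<bar>\<close> be almost \<open>\<parallel>A\<parallel> = 1\<close>. Because \<open>p, q > 2\<close>, perturbing \<open>x\<close> far out costs less in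
  norm than the second-order gain of the form, so \<open>A\<close> must nearly vanish on tails. Hence \<open>A\<close> is
  determined, up to a small norm error and uniformly in \<open>A\<close>, by finitely many of its coefficients,
  and any sequence of forms with \<open>\<bar>A\<^sub>n x y\<bar> \<rightarrow> 1\<close> has a norm-convergent subsequence, whose limit
  attains its norm at \<open>(x, y)\<close>.

  For \<open>(b)\<close>, if \<open>1/p + 1/q < 1\<close>, then \<open>A\<close> nearly vanishes on tails (Pitt's theorem: two disjoint
  blocks double the value of the form, but multiply the norms only by \<open>2 powr (1/p + 1/q) < 2\<close>). So \<open>A\<close> is continuous for
  coordinatewise convergence of unit vectors, and a limit pair of an almost attaining sequence attains
  \<open>\<parallel>A\<parallel>\<close>; its vectors are then unit vectors, which upgrades the convergence to norm convergence.
  If \<open>1/p + 1/q \<ge> 1\<close>, a diagonal form with weights increasing to \<open>1\<close> has norm \<open>1\<close> but does not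
  attain it.
\<close>

text \<open>The two parts differ in what a cutoff index may depend on. In (b) the form is fixed, so
  the cutoff may depend on it. In (a) \<open>\<eta>\<close> may depend on \<open>(x, y)\<close> but
  not on the form, and no cutoff serves all forms of norm 1: \<open>u n * v n\<close> is such a form
  for every \<open>n\<close>. The uniformity has to come from near attainment at the given pair, so
  a quantitative smoothness bound for the norm replaces the doubling argument. The gain from
  perturbing both arguments is of second order, so a first-order loss in either norm would swamp it.
  Signs are averaged to cancel first-order terms in the second argument, and disjoint supports give
  a loss of order \<open>t powr p\<close> in the first. The roles of the arguments are then
  exchanged, whence both exponents exceed 2. Real and complex scalars share one proof; the inner
  product of \<open>euclidean_space\<close> enters only through the smoothness bound.\<close>

subsection \<open>The spaces \<open>\<ell>\<^sub>p\<close>\<close>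

text \<open>The \<open>p\<close>-th power of the norm. It is additive over disjoint supports, so
  most estimates are made here and carried to \<open>nrm\<close> by taking a root at the
  end.\<close>

definition lp_sum :: "real \<Rightarrow> (nat \<Rightarrow> 'k::real_normed_field) \<Rightarrow> real" where
  "lp_sum p x = (\<Sum>n. norm (x n) powr p)"

definition initial :: "nat \<Rightarrow> (nat \<Rightarrow> 'k::zero) \<Rightarrow> nat \<Rightarrow> 'k" where
  "initial N x = (\<lambda>n. if n < N then x n else 0)"

definition tail :: "nat \<Rightarrow> (nat \<Rightarrow> 'k::zero) \<Rightarrow> nat \<Rightarrow> 'k" where
  "tail N x = (\<lambda>n. if n < N then 0 else x n)"

definition unit_seq :: "nat \<Rightarrow> nat \<Rightarrow> 'k::zero_neq_one" where
  "unit_seq i = (\<lambda>n. if n = i then 1 else 0)"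

lemma carr_lp: "x \<in> carr (lp p) \<longleftrightarrow> summable (\<lambda>n. norm (x n) powr p)"
  by (simp add: lp_def)

lemma nrm_lp: "nrm (lp p) x = lp_sum p x powr (1 / p)"
  by (simp add: lp_def lp_sum_def)

lemma nrm_nonneg [simp]: "0 \<le> nrm (lp p) x"
  by (simp add: nrm_lp)

lemma lp_sum_nonneg: "x \<in> carr (lp p) \<Longrightarrow> 0 \<le> lp_sum p x"
  unfolding lp_sum_def carr_lp by (rule suminf_nonneg) auto

lemma nrm_powr: "x \<in> carr (lp p) \<Longrightarrow> 0 < p \<Longrightarrow> nrm (lp p) x powr p = lp_sum p x"
  by (simp add: nrm_lp powr_powr lp_sum_nonneg)

lemma nrm_mono:
  assumes "x \<in> carr (lp p)" "0 < p" "lp_sum p x \<le> lp_sum p y"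
  shows "nrm (lp p) x \<le> nrm (lp p) y"
  using assms by (simp add: nrm_lp powr_mono2 lp_sum_nonneg)

lemma usphere_lp:
  assumes "0 < p"
  shows "x \<in> usphere (lp p) \<longleftrightarrow> x \<in> carr (lp p) \<and> lp_sum p x = 1"
proof -
  have "lp_sum p x = 1" if "x \<in> carr (lp p)" "nrm (lp p) x = 1"
    using nrm_powr[OF that(1) assms] that by simp
  then show ?thesis
    by (auto simp: usphere_def nrm_lp)
qed

lemma usphere_lpD:
  assumes "x \<in> usphere (lp p)"
  shows "x \<in> carr (lp p)" "nrm (lp p) x = 1"
  using assms by (auto simp: usphere_def)

lemma nrm_eq_0D:
  assumes "x \<in> carr (lp p)" "0 < p" "nrm (lp p) x = 0"
  shows "x = (\<lambda>n. 0)"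
proof -
  have "lp_sum p x = 0"
    using assms by (simp add: nrm_lp)
  then have "norm (x n) powr p = 0" for n
    using assms suminf_eq_zero_iff[of "\<lambda>n. norm (x n) powr p"] by (simp add: lp_sum_def carr_lp)
  then show ?thesis by auto
qed

lemma norm_le_nrm:
  assumes "x \<in> carr (lp p)" "0 < p"
  shows "norm (x n) \<le> nrm (lp p) x"
proof -
  have "norm (x n) powr p \<le> lp_sum p x"
    using sum_le_suminf[of "\<lambda>n. norm (x n) powr p" "{n}"] assms
    by (simp add: lp_sum_def carr_lp)
  then have "(norm (x n) powr p) powr (1/p) \<le> lp_sum p x powr (1/p)"
    using assms by (intro powr_mono2) auto
  then show ?thesis
    using assms by (simp add: nrm_lp powr_powr)
qed

lemma carr_scale [simp]: "x \<in> carr (lp p) \<Longrightarrow> (\<lambda>n. c * x n) \<in> carr (lp p)"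
  by (simp add: carr_lp norm_mult powr_mult summable_mult)

lemma lp_sum_scale:
  "x \<in> carr (lp p) \<Longrightarrow> lp_sum p (\<lambda>n. c * x n) = norm c powr p * lp_sum p x"
  by (simp add: carr_lp lp_sum_def norm_mult powr_mult suminf_mult)

lemma nrm_scale:
  "x \<in> carr (lp p) \<Longrightarrow> 0 < p \<Longrightarrow> nrm (lp p) (\<lambda>n. c * x n) = norm c * nrm (lp p) x"
  by (simp add: nrm_lp lp_sum_scale powr_mult powr_powr lp_sum_nonneg)

text \<open>A crude substitute for Minkowski's inequality. The constant \<open>2 powr p\<close> does
  no harm: it serves only closure of the carrier under addition and a convergence to 0.\<close>

lemma norm_add_powr_le:
  fixes a b :: "'a::real_normed_vector"
  assumes "0 < p"
  shows "norm (a + b) powr p \<le> 2 powr p * (norm a powr p + norm b powr p)"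
proof -
  have "norm (a + b) \<le> 2 * max (norm a) (norm b)"
    using norm_triangle_ineq[of a b] by linarith
  then have "norm (a + b) powr p \<le> (2 * max (norm a) (norm b)) powr p"
    using assms by (intro powr_mono2) auto
  also have "\<dots> = 2 powr p * max (norm a) (norm b) powr p"
    by (simp add: powr_mult)
  also have "\<dots> \<le> 2 powr p * (norm a powr p + norm b powr p)"
    by (intro mult_left_mono) (auto simp: max_def)
  finally show ?thesis .
qed

lemma carr_add [simp]:
  assumes "x \<in> carr (lp p)" "y \<in> carr (lp p)" "0 < p"
  shows "(\<lambda>n. x n + y n) \<in> carr (lp p)"
  unfolding carr_lp
proof (rule summable_comparison_test')
  show "summable (\<lambda>n. 2 powr p * (norm (x n) powr p + norm (y n) powr p))"
    using assms by (intro summable_mult summable_add) (auto simp: carr_lp)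
qed (use norm_add_powr_le[OF assms(3)] in auto)

lemma lp_sum_add_le:
  assumes "x \<in> carr (lp p)" "y \<in> carr (lp p)" "0 < p"
  shows "lp_sum p (\<lambda>n. x n + y n) \<le> 2 powr p * (lp_sum p x + lp_sum p y)"
proof -
  have s: "summable (\<lambda>n. norm (x n) powr p)" "summable (\<lambda>n. norm (y n) powr p)"
    using assms by (auto simp: carr_lp)
  have "lp_sum p (\<lambda>n. x n + y n) \<le> (\<Sum>n. 2 powr p * (norm (x n) powr p + norm (y n) powr p))"
    unfolding lp_sum_def using carr_add[OF assms] norm_add_powr_le[OF assms(3)] s
    by (intro suminf_le summable_mult summable_add) (auto simp: carr_lp)
  also have "\<dots> = 2 powr p * (lp_sum p x + lp_sum p y)"
    using s by (simp add: lp_sum_def suminf_add suminf_mult summable_add)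
  finally show ?thesis .
qed

lemma carr_uminus [simp]: "x \<in> carr (lp p) \<Longrightarrow> (\<lambda>n. - x n) \<in> carr (lp p)"
  by (simp add: carr_lp)

lemma lp_sum_uminus [simp]: "lp_sum p (\<lambda>n. - x n) = lp_sum p x"
  by (simp add: lp_sum_def)

lemma carr_diff [simp]:
  assumes "x \<in> carr (lp p)" "y \<in> carr (lp p)" "0 < p"
  shows "(\<lambda>n. x n - y n) \<in> carr (lp p)"
  using carr_add[OF assms(1) carr_uminus[OF assms(2)] assms(3)] by simp

lemma lp_sum_diff_le:
  assumes "x \<in> carr (lp p)" "y \<in> carr (lp p)" "0 < p"
  shows "lp_sum p (\<lambda>n. x n - y n) \<le> 2 powr p * (lp_sum p x + lp_sum p y)"
  using lp_sum_add_le[OF assms(1) carr_uminus[OF assms(2)] assms(3)] by simp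

lemma carr_zero [simp]: "(\<lambda>n. 0) \<in> carr (lp p)"
  by (simp add: carr_lp)

lemma carr_unit_seq [simp]: "unit_seq i \<in> carr (lp p)"
  unfolding carr_lp by (rule summable_finite[of "{i}"]) (auto simp: unit_seq_def)

lemma lp_sum_unit_seq [simp]: "lp_sum p (unit_seq i :: nat \<Rightarrow> 'k::real_normed_field) = 1"
proof -
  have "lp_sum p (unit_seq i :: nat \<Rightarrow> 'k) = (\<Sum>n\<in>{i}. norm (unit_seq i n :: 'k) powr p)"
    unfolding lp_sum_def by (rule suminf_finite) (auto simp: unit_seq_def)
  then show ?thesis by (simp add: unit_seq_def)
qed

lemma unit_seq_usphere [simp]: "unit_seq i \<in> usphere (lp p)"
  by (simp add: usphere_def nrm_lp)

section \<open>Splitting a sequence at an index\<close>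

lemma initial_add_tail: "(\<lambda>n. initial N x n + tail N x n) = x"
  for x :: "nat \<Rightarrow> 'k::real_normed_field"
  by (auto simp: initial_def tail_def)

lemma carr_initial [simp]: "initial N x \<in> carr (lp p)"
  unfolding carr_lp by (rule summable_finite[of "{..<N}"]) (auto simp: initial_def)

lemma lp_sum_initial: "lp_sum p (initial N x) = (\<Sum>n<N. norm (x n) powr p)"
proof -
  have "lp_sum p (initial N x) = (\<Sum>n<N. norm (initial N x n) powr p)"
    unfolding lp_sum_def by (rule suminf_finite) (auto simp: initial_def)
  then show ?thesis by (simp add: initial_def)
qed

lemma carr_tail [simp]: "x \<in> carr (lp p) \<Longrightarrow> tail N x \<in> carr (lp p)"
  unfolding carr_lp tail_def by (rule summable_comparison_test'[where N=0]) auto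

lemma lp_sum_disjoint:
  assumes "x \<in> carr (lp p)" "y \<in> carr (lp p)" "\<And>n. x n = 0 \<or> y n = 0"
  shows "lp_sum p (\<lambda>n. x n + y n) = lp_sum p x + lp_sum p y"
proof -
  have "norm (x n + y n) powr p = norm (x n) powr p + norm (y n) powr p" for n
    using assms(3)[of n] by auto
  then show ?thesis
    using assms by (simp add: lp_sum_def carr_lp suminf_add)
qed

lemma lp_sum_split:
  assumes "x \<in> carr (lp p)"
  shows "lp_sum p x = lp_sum p (initial N x) + lp_sum p (tail N x)"
proof -
  have "lp_sum p (\<lambda>n. initial N x n + tail N x n) = lp_sum p (initial N x) + lp_sum p (tail N x)"
    by (intro lp_sum_disjoint carr_initial carr_tail assms) (auto simp: initial_def tail_def)
  then show ?thesis
    by (simp only: initial_add_tail)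
qed

lemma lp_sum_initial_le: "x \<in> carr (lp p) \<Longrightarrow> lp_sum p (initial N x) \<le> lp_sum p x"
  using lp_sum_split[of x p N] lp_sum_nonneg[of "tail N x" p] by simp

lemma lp_sum_tail_le: "x \<in> carr (lp p) \<Longrightarrow> lp_sum p (tail N x) \<le> lp_sum p x"
  using lp_sum_split[of x p N] lp_sum_nonneg[of "initial N x" p] by simp

lemma nrm_initial_le: "x \<in> carr (lp p) \<Longrightarrow> 0 < p \<Longrightarrow> nrm (lp p) (initial N x) \<le> nrm (lp p) x"
  by (simp add: nrm_mono lp_sum_initial_le)

lemma nrm_tail_le: "x \<in> carr (lp p) \<Longrightarrow> 0 < p \<Longrightarrow> nrm (lp p) (tail N x) \<le> nrm (lp p) x"
  by (simp add: nrm_mono lp_sum_tail_le)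

lemma lp_sum_initial_tendsto:
  assumes "x \<in> carr (lp p)"
  shows "(\<lambda>N. lp_sum p (initial N x)) \<longlonglongrightarrow> lp_sum p x"
  using assms unfolding lp_sum_initial unfolding lp_sum_def carr_lp by (rule summable_LIMSEQ)

lemma lp_sum_tail_tendsto:
  assumes "x \<in> carr (lp p)"
  shows "(\<lambda>N. lp_sum p (tail N x)) \<longlonglongrightarrow> 0"
proof -
  have "(\<lambda>N. lp_sum p x - lp_sum p (initial N x)) \<longlonglongrightarrow> lp_sum p x - lp_sum p x"
    by (intro tendsto_intros lp_sum_initial_tendsto assms)
  moreover have "lp_sum p x - lp_sum p (initial N x) = lp_sum p (tail N x)" for N
    using lp_sum_split[OF assms, of N] by simp
  ultimately show ?thesis by simp
qed

lemma nrm_tendsto_0: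
  assumes "(\<lambda>n. lp_sum p (f n)) \<longlonglongrightarrow> 0" "\<And>n. f n \<in> carr (lp p)" "0 < p"
  shows "(\<lambda>n. nrm (lp p) (f n)) \<longlonglongrightarrow> 0"
  unfolding nrm_lp
  by (rule tendsto_zero_powrI[where b = "1 / p"]) (use assms in \<open>auto simp: lp_sum_nonneg\<close>)

lemma nrm_tail_tendsto:
  "x \<in> carr (lp p) \<Longrightarrow> 0 < p \<Longrightarrow> (\<lambda>N. nrm (lp p) (tail N x)) \<longlonglongrightarrow> 0"
  by (rule nrm_tendsto_0) (auto simp: lp_sum_tail_tendsto)

text \<open>Disjoint supports make the \<open>p\<close>-th powers add, so a perturbation of norm
  \<open>t\<close> costs only order \<open>t powr p\<close>; the case \<open>t = 1\<close> gives the
  factor \<open>2 powr (1 / p)\<close>.\<close>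

lemma nrm_disjoint_le:
  assumes "x \<in> carr (lp p)" "y \<in> carr (lp p)" "\<And>n. x n = 0 \<or> y n = 0" "0 < p"
    and "nrm (lp p) x \<le> 1" "nrm (lp p) y \<le> t"
  shows "nrm (lp p) (\<lambda>n. x n + y n) \<le> (1 + t powr p) powr (1 / p)"
proof -
  have "lp_sum p x \<le> 1 powr p" "lp_sum p y \<le> t powr p"
    using assms by (auto simp flip: nrm_powr intro!: powr_mono2 powr_le1)
  then show ?thesis
    unfolding nrm_lp using assms by (intro powr_mono2) (auto simp: lp_sum_disjoint lp_sum_nonneg)
qed

subsection \<open>Bounded bilinear forms on \<open>\<ell>\<^sub>p \<times> \<ell>\<^sub>q\<close>\<close>

lemma bounded_bilinear_formsI:
  assumes "\<And>x x' y. x \<in> carr X \<Longrightarrow> x' \<in> carr X \<Longrightarrow> y \<in> carr Y \<Longrightarrow>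
      A (\<lambda>n. x n + x' n) y = A x y + A x' y"
    and "\<And>x y y'. x \<in> carr X \<Longrightarrow> y \<in> carr Y \<Longrightarrow> y' \<in> carr Y \<Longrightarrow>
      A x (\<lambda>n. y n + y' n) = A x y + A x y'"
    and "\<And>c x y. x \<in> carr X \<Longrightarrow> y \<in> carr Y \<Longrightarrow> A (\<lambda>n. c * x n) y = c * A x y"
    and "\<And>c x y. x \<in> carr X \<Longrightarrow> y \<in> carr Y \<Longrightarrow> A x (\<lambda>n. c * y n) = c * A x y"
    and "\<And>x y. x \<in> carr X \<Longrightarrow> y \<in> carr Y \<Longrightarrow> norm (A x y) \<le> C * nrm X x * nrm Y y"
  shows "A \<in> bounded_bilinear_forms X Y"
  using assms unfolding bounded_bilinear_forms_def by blast

context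
  fixes X Y :: "'k::real_normed_field seq_space" and A
  assumes A: "A \<in> bounded_bilinear_forms X Y"
begin

lemma form_add_left:
  "x \<in> carr X \<Longrightarrow> x' \<in> carr X \<Longrightarrow> y \<in> carr Y \<Longrightarrow> A (\<lambda>n. x n + x' n) y = A x y + A x' y"
  using A unfolding bounded_bilinear_forms_def by blast

lemma form_add_right:
  "x \<in> carr X \<Longrightarrow> y \<in> carr Y \<Longrightarrow> y' \<in> carr Y \<Longrightarrow> A x (\<lambda>n. y n + y' n) = A x y + A x y'"
  using A unfolding bounded_bilinear_forms_def by blast

lemma form_scale_left: "x \<in> carr X \<Longrightarrow> y \<in> carr Y \<Longrightarrow> A (\<lambda>n. c * x n) y = c * A x y"
  using A unfolding bounded_bilinear_forms_def by blast

lemma form_scale_right: "x \<in> carr X \<Longrightarrow> y \<in> carr Y \<Longrightarrow> A x (\<lambda>n. c * y n) = c * A x y"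
  using A unfolding bounded_bilinear_forms_def by blast

text \<open>In an arbitrary record \<open>nrm\<close> may be negative, so raising the constant to
  \<open>max 0 C\<close> is sound only under the two sign premises.\<close>

lemma form_bounded:
  obtains C where "0 \<le> C"
    "\<And>x y. x \<in> carr X \<Longrightarrow> y \<in> carr Y \<Longrightarrow> 0 \<le> nrm X x \<Longrightarrow> 0 \<le> nrm Y y \<Longrightarrow>
       norm (A x y) \<le> C * nrm X x * nrm Y y"
proof -
  obtain C where C: "\<And>x y. x \<in> carr X \<Longrightarrow> y \<in> carr Y \<Longrightarrow> norm (A x y) \<le> C * nrm X x * nrm Y y"
    using A unfolding bounded_bilinear_forms_def by blast
  have "norm (A x y) \<le> max 0 C * nrm X x * nrm Y y"
    if "x \<in> carr X" "y \<in> carr Y" "0 \<le> nrm X x" "0 \<le> nrm Y y" for x y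
    using C[OF that(1,2)] mult_right_mono[OF mult_right_mono[OF max.cobounded2[of C 0] that(3)] that(4)]
    by linarith
  then show ?thesis using that[of "max 0 C"] by auto
qed

lemma form_zero_left: "x \<in> carr X \<Longrightarrow> y \<in> carr Y \<Longrightarrow> A (\<lambda>n. 0) y = 0"
  using form_scale_left[of x y 0] by simp

lemma form_zero_right: "x \<in> carr X \<Longrightarrow> y \<in> carr Y \<Longrightarrow> A x (\<lambda>n. 0) = 0"
  using form_scale_right[of x y 0] by simp

text \<open>With this, every estimate for tails in the first argument yields one for the
  second.\<close>

lemma form_flip: "(\<lambda>y x. A x y) \<in> bounded_bilinear_forms Y X"
proof -
  obtain C where "\<And>x y. x \<in> carr X \<Longrightarrow> y \<in> carr Y \<Longrightarrow> norm (A x y) \<le> C * nrm X x * nrm Y y"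
    using A unfolding bounded_bilinear_forms_def by blast
  then show ?thesis
    by (intro bounded_bilinear_formsI[where C = C])
      (auto simp: form_add_left form_add_right form_scale_left form_scale_right mult_ac)
qed

end

lemma form_norm_flip: "form_norm Y X (\<lambda>y x. A x y) = form_norm X Y A"
proof -
  have "{norm (A x y) | y x. y \<in> usphere Y \<and> x \<in> usphere X} =
      {norm (A x y) | x y. x \<in> usphere X \<and> y \<in> usphere Y}"
    by blast
  then show ?thesis
    by (simp only: form_norm_def)
qed

section \<open>From bounds on unit spheres to bounds on the carriers\<close>

lemma form_norm_le:
  assumes "\<And>x y. x \<in> usphere (lp p) \<Longrightarrow> y \<in> usphere (lp q) \<Longrightarrow> norm (A x y) \<le> K"
  shows "form_norm (lp p) (lp q) A \<le> K"
  unfolding form_norm_def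
proof (rule cSup_least)
  show "{norm (A x y) |x y. x \<in> usphere (lp p) \<and> y \<in> usphere (lp q)} \<noteq> {}"
    using unit_seq_usphere by blast
qed (use assms in auto)

lemma le_form_norm:
  assumes "A \<in> bounded_bilinear_forms (lp p) (lp q)" "x \<in> usphere (lp p)" "y \<in> usphere (lp q)"
  shows "norm (A x y) \<le> form_norm (lp p) (lp q) A"
proof -
  obtain C where "\<And>x y. x \<in> carr (lp p) \<Longrightarrow> y \<in> carr (lp q) \<Longrightarrow>
      norm (A x y) \<le> C * nrm (lp p) x * nrm (lp q) y"
    using assms(1) unfolding bounded_bilinear_forms_def by blast
  then have "norm (A x y) \<le> C" if "x \<in> usphere (lp p)" "y \<in> usphere (lp q)" for x y
    using that by (force simp: usphere_def)
  then have "bdd_above {norm (A x y) |x y. x \<in> usphere (lp p) \<and> y \<in> usphere (lp q)}"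
    by (intro bdd_aboveI[where M = C]) auto
  then show ?thesis
    unfolding form_norm_def using assms by (intro cSup_upper) auto
qed

lemma form_left_le_of_usphere:
  assumes A: "A \<in> bounded_bilinear_forms (lp p) (lp q)" and p: "0 < p"
    and y: "y \<in> carr (lp q)" and K: "\<And>x. x \<in> usphere (lp p) \<Longrightarrow> norm (A x y) \<le> K"
    and x: "x \<in> carr (lp p)"
  shows "norm (A x y) \<le> K * nrm (lp p) x"
proof (cases "nrm (lp p) x = 0")
  case True
  then show ?thesis
    using nrm_eq_0D[OF x p] form_zero_left[OF A x y] by simp
next
  case False
  define d where "d = nrm (lp p) x"
  have d: "0 < d"
    using False nrm_nonneg[of p x] unfolding d_def by linarith
  define u where "u = (\<lambda>n. inverse (of_real d) * x n)"
  have "u \<in> usphere (lp p)"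
    using x p d by (auto simp: usphere_def u_def nrm_scale norm_inverse d_def)
  then have "norm (A u y) \<le> K" by (rule K)
  moreover have "norm (A u y) = inverse d * norm (A x y)"
    using form_scale_left[OF A x y] d by (simp add: u_def norm_mult norm_inverse)
  ultimately show ?thesis
    using d by (simp add: field_simps d_def)
qed

lemma form_le_of_usphere:
  assumes A: "A \<in> bounded_bilinear_forms (lp p) (lp q)" and pq: "0 < p" "0 < q"
    and K: "\<And>x y. x \<in> usphere (lp p) \<Longrightarrow> y \<in> usphere (lp q) \<Longrightarrow> norm (A x y) \<le> K"
    and xy: "x \<in> carr (lp p)" "y \<in> carr (lp q)"
  shows "norm (A x y) \<le> K * nrm (lp p) x * nrm (lp q) y"
proof (rule form_left_le_of_usphere[OF form_flip[OF A] pq(2) xy(1) _ xy(2)])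
  fix y :: "nat \<Rightarrow> 'a" assume "y \<in> usphere (lp q)"
  then show "norm (A x y) \<le> K * nrm (lp p) x"
    by (intro form_left_le_of_usphere[OF A pq(1) _ _ xy(1)] K usphere_lpD(1))
qed

lemma form_le:
  assumes "A \<in> bounded_bilinear_forms (lp p) (lp q)" "0 < p" "0 < q"
    and "x \<in> carr (lp p)" "y \<in> carr (lp q)"
  shows "norm (A x y) \<le> form_norm (lp p) (lp q) A * nrm (lp p) x * nrm (lp q) y"
  using assms le_form_norm by (intro form_le_of_usphere) auto

section \<open>Truncated arguments and the matrix of a form\<close>

lemma form_truncate_left:
  assumes "A \<in> bounded_bilinear_forms (lp p) (lp q)" "0 < p"
    "x \<in> carr (lp p)" "y \<in> carr (lp q)"
  shows "A x y = A (initial N x) y + A (tail N x) y"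
  using form_add_left[OF assms(1), of "initial N x" "tail N x" y] assms
  by (simp add: initial_add_tail)

lemma form_truncate_right:
  assumes "A \<in> bounded_bilinear_forms (lp p) (lp q)" "0 < q"
    "x \<in> carr (lp p)" "y \<in> carr (lp q)"
  shows "A x y = A x (initial N y) + A x (tail N y)"
  using form_add_right[OF assms(1), of x "initial N y" "tail N y"] assms
  by (simp add: initial_add_tail)

lemma initial_0: "initial 0 x = (\<lambda>n. 0)"
  by (simp add: initial_def)

lemma initial_Suc:
  fixes x :: "nat \<Rightarrow> 'k::real_normed_field"
  shows "initial (Suc N) x = (\<lambda>n. initial N x n + x N * unit_seq N n)"
  by (auto simp: initial_def unit_seq_def less_Suc_eq)

lemma form_initial_left:
  assumes "A \<in> bounded_bilinear_forms (lp p) (lp q)" "0 < p" "y \<in> carr (lp q)"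
  shows "A (initial N x) y = (\<Sum>i<N. x i * A (unit_seq i) y)"
proof (induction N)
  case 0
  then show ?case
    using form_zero_left[OF assms(1) carr_zero assms(3)] by (simp add: initial_0)
next
  case (Suc N)
  have "A (initial (Suc N) x) y = A (initial N x) y + A (\<lambda>n. x N * unit_seq N n) y"
    unfolding initial_Suc using assms by (intro form_add_left[OF assms(1)]) auto
  then show ?case
    using Suc form_scale_left[OF assms(1) carr_unit_seq assms(3)] by simp
qed

lemma form_initial_right:
  assumes "A \<in> bounded_bilinear_forms (lp p) (lp q)" "0 < q" "x \<in> carr (lp p)"
  shows "A x (initial N y) = (\<Sum>i<N. y i * A x (unit_seq i))"
proof (induction N)
  case 0
  then show ?case
    using form_zero_right[OF assms(1) assms(3) carr_zero] by (simp add: initial_0)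
next
  case (Suc N)
  have "A x (initial (Suc N) y) = A x (initial N y) + A x (\<lambda>n. y N * unit_seq N n)"
    unfolding initial_Suc using assms by (intro form_add_right[OF assms(1)]) auto
  then show ?case
    using Suc form_scale_right[OF assms(1) assms(3) carr_unit_seq] by simp
qed

lemma form_initial:
  assumes "A \<in> bounded_bilinear_forms (lp p) (lp q)" "0 < p" "0 < q"
  shows "A (initial N x) (initial M y) = (\<Sum>i<N. \<Sum>j<M. x i * (y j * A (unit_seq i) (unit_seq j)))"
  using assms by (simp add: form_initial_left form_initial_right sum_distrib_left)

text \<open>The difference is \<open>A (tail N x) y + A (initial N x) (tail M y)\<close>, hence the
  factor 2. Tail bounds in both arguments thus reduce \<open>A\<close> to a finite matrix.\<close>

lemma form_initial_approx:
  assumes A: "A \<in> bounded_bilinear_forms (lp p) (lp q)" and pq: "0 < p" "0 < q"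
    and xy: "x \<in> carr (lp p)" "y \<in> carr (lp q)"
    and l: "\<And>x y. x \<in> carr (lp p) \<Longrightarrow> y \<in> carr (lp q) \<Longrightarrow>
        norm (A (tail N x) y) \<le> e * nrm (lp p) x * nrm (lp q) y"
    and r: "\<And>x y. x \<in> carr (lp p) \<Longrightarrow> y \<in> carr (lp q) \<Longrightarrow>
        norm (A x (tail M y)) \<le> e * nrm (lp p) x * nrm (lp q) y"
    and e: "0 \<le> e"
  shows "norm (A x y - A (initial N x) (initial M y)) \<le> 2 * e * nrm (lp p) x * nrm (lp q) y"
proof -
  have eq: "A x y - A (initial N x) (initial M y) = A (tail N x) y + A (initial N x) (tail M y)"
    using form_truncate_left[OF A pq(1) xy, of N]
      form_truncate_right[OF A pq(2) carr_initial[of N x] xy(2), of M] by simp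
  have "norm (A (initial N x) (tail M y)) \<le> e * nrm (lp p) (initial N x) * nrm (lp q) y"
    using xy by (intro r) auto
  moreover have "\<dots> \<le> e * nrm (lp p) x * nrm (lp q) y"
    using e xy pq by (intro mult_right_mono mult_left_mono nrm_initial_le) auto
  ultimately show ?thesis
    unfolding eq
    using l[OF xy] norm_triangle_ineq[of "A (tail N x) y" "A (initial N x) (tail M y)"] by linarith
qed

lemma form_initial_tendsto:
  assumes A: "A \<in> bounded_bilinear_forms (lp p) (lp q)" and pq: "0 < p" "0 < q"
    and xy: "x \<in> carr (lp p)" "y \<in> carr (lp q)"
  shows "(\<lambda>N. A (initial N x) (initial N y)) \<longlonglongrightarrow> A x y"
proof -
  obtain C where C: "0 \<le> C" "\<And>x y. x \<in> carr (lp p) \<Longrightarrow> y \<in> carr (lp q) \<Longrightarrow>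
       norm (A x y) \<le> C * nrm (lp p) x * nrm (lp q) y"
    using form_bounded[OF A] nrm_nonneg by metis
  have le: "norm (A (initial N x) (initial N y) - A x y) \<le>
      C * nrm (lp p) (tail N x) * nrm (lp q) y + C * nrm (lp p) x * nrm (lp q) (tail N y)" for N
  proof -
    have eq: "A (initial N x) (initial N y) - A x y = - (A (tail N x) y + A (initial N x) (tail N y))"
      using form_truncate_left[OF A pq(1) xy, of N]
        form_truncate_right[OF A pq(2) carr_initial[of N x] xy(2), of N] by simp
    have "norm (A (initial N x) (tail N y)) \<le> C * nrm (lp p) (initial N x) * nrm (lp q) (tail N y)"
      using xy by (intro C) auto
    moreover have "\<dots> \<le> C * nrm (lp p) x * nrm (lp q) (tail N y)"
      using C xy pq by (intro mult_right_mono mult_left_mono nrm_initial_le) auto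
    moreover have "norm (A (tail N x) y) \<le> C * nrm (lp p) (tail N x) * nrm (lp q) y"
      using xy by (intro C) auto
    ultimately show ?thesis
      unfolding eq norm_minus_cancel
      using norm_triangle_ineq[of "A (tail N x) y" "A (initial N x) (tail N y)"] by linarith
  qed
  have lim: "(\<lambda>N. C * nrm (lp p) (tail N x) * nrm (lp q) y + C * nrm (lp p) x * nrm (lp q) (tail N y))
      \<longlonglongrightarrow> C * 0 * nrm (lp q) y + C * nrm (lp p) x * 0"
    by (intro tendsto_add tendsto_mult tendsto_const nrm_tail_tendsto xy pq)
  have "(\<lambda>N. A (initial N x) (initial N y) - A x y) \<longlonglongrightarrow> 0"
    by (rule Lim_null_comparison[OF _ lim[simplified]]) (use le in auto)
  then show ?thesis
    by (rule LIM_zero_cancel)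
qed

text \<open>Rotating \<open>b\<close> into the direction of \<open>a\<close> makes the triangle
  inequality an equality, so that two separate contributions to a form add up.\<close>

lemma exists_phase:
  fixes a b :: "'k::real_normed_field"
  shows "\<exists>k. norm k = 1 \<and> norm (a + k * b) = norm a + norm b"
proof (cases "a = 0 \<or> b = 0")
  case True
  then show ?thesis by (intro exI[of _ 1]) auto
next
  case False
  define k where "k = a / of_real (norm a) * (of_real (norm b) / b)"
  have "a + k * b = a / of_real (norm a) * of_real (norm a + norm b)"
    using False by (simp add: k_def field_simps)
  then have "norm (a + k * b) = norm a / norm a * (norm a + norm b)"
    by (simp only: norm_mult norm_divide norm_of_real) simp
  then have "norm (a + k * b) = norm a + norm b"
    using False by simp
  moreover have "norm k = 1"
    using False by (simp add: k_def norm_mult norm_divide)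
  ultimately show ?thesis by blast
qed

text \<open>Averaging over the sign change \<open>(u, v) \<mapsto> (-u, -v)\<close> removes the mixed terms \<open>A x v\<close> and \<open>A u y\<close>.\<close>

lemma form_sign_average:
  assumes A: "A \<in> bounded_bilinear_forms (lp p) (lp q)" and pq: "0 < p" "0 < q"
    and xu: "x \<in> carr (lp p)" "u \<in> carr (lp p)" and yv: "y \<in> carr (lp q)" "v \<in> carr (lp q)"
  shows "\<exists>k. norm k = 1 \<and> 2 * (norm (A x y) + norm (A u v)) \<le>
    norm (A (\<lambda>n. x n + u n) (\<lambda>n. y n + k * v n)) + norm (A (\<lambda>n. x n + - u n) (\<lambda>n. y n + - (k * v n)))"
proof -
  obtain k where k: "norm k = 1" "norm (A x y + k * A u v) = norm (A x y) + norm (A u v)"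
    using exists_phase[of "A x y" "A u v"] by blast
  have vk: "(\<lambda>n. k * v n) \<in> carr (lp q)" "(\<lambda>n. - (k * v n)) \<in> carr (lp q)"
    and u': "(\<lambda>n. - u n) \<in> carr (lp p)"
    using xu yv by auto
  let ?P = "A (\<lambda>n. x n + u n) (\<lambda>n. y n + k * v n)"
  let ?M = "A (\<lambda>n. x n + - u n) (\<lambda>n. y n + - (k * v n))"
  have neg: "A (\<lambda>n. - u n) w = - A u w" if "w \<in> carr (lp q)" for w
    using form_scale_left[OF A xu(2) that, of "-1"] by simp
  have kv: "A w (\<lambda>n. k * v n) = k * A w v" "A w (\<lambda>n. - (k * v n)) = - (k * A w v)"
    if "w \<in> carr (lp p)" for w
    using form_scale_right[OF A that yv(2), of k] form_scale_right[OF A that yv(2), of "-k"] by auto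
  have yk: "(\<lambda>n. y n + k * v n) \<in> carr (lp q)" "(\<lambda>n. y n + - (k * v n)) \<in> carr (lp q)"
    by (intro carr_add yv vk pq)+
  have "?P = (A x y + k * A x v) + (A u y + k * A u v)"
    by (simp only: form_add_left[OF A xu yk(1)] form_add_right[OF A xu(1) yv(1) vk(1)]
        form_add_right[OF A xu(2) yv(1) vk(1)] kv xu)
  moreover have "?M = (A x y - k * A x v) + (- A u y + k * A u v)"
    by (simp only: form_add_left[OF A xu(1) u' yk(2)] neg[OF yk(2)] kv xu
        form_add_right[OF A xu(1) yv(1) vk(2)] form_add_right[OF A xu(2) yv(1) vk(2)]) simp
  ultimately have "?P + ?M = of_real 2 * (A x y + k * A u v)"
    by simp
  then have "norm (?P + ?M) = 2 * (norm (A x y) + norm (A u v))"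
    by (simp only: norm_mult k norm_of_real)
  moreover have "norm (?P + ?M) \<le> norm ?P + norm ?M"
    by (rule norm_triangle_ineq)
  ultimately have "2 * (norm (A x y) + norm (A u v)) \<le> norm ?P + norm ?M"
    by simp
  then show ?thesis
    using k(1) by (intro exI[of _ k]) simp
qed

subsection \<open>Compactness of bilinear forms when \<open>1/p + 1/q < 1\<close>\<close>

lemma tail_add: "tail N (\<lambda>n. x n + y n) = (\<lambda>n. tail N x n + tail N y n)"
  for x :: "nat \<Rightarrow> 'k::real_normed_field"
  by (auto simp: tail_def)

lemma tail_scale: "tail N (\<lambda>n. c * x n) = (\<lambda>n. c * tail N x n)"
  for x :: "nat \<Rightarrow> 'k::real_normed_field"
  by (auto simp: tail_def)

lemma tail_tail: "M \<le> N \<Longrightarrow> tail M (tail N x) = tail N x"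
  by (auto simp: tail_def)

lemma form_tail:
  assumes A: "A \<in> bounded_bilinear_forms (lp p) (lp q)" and pq: "0 < p" "0 < q"
  shows "(\<lambda>x y. A (tail N x) (tail M y)) \<in> bounded_bilinear_forms (lp p) (lp q)"
proof -
  obtain C where C: "0 \<le> C" "\<And>x y. x \<in> carr (lp p) \<Longrightarrow> y \<in> carr (lp q) \<Longrightarrow>
       norm (A x y) \<le> C * nrm (lp p) x * nrm (lp q) y"
    using form_bounded[OF A] nrm_nonneg by metis
  have "norm (A (tail N x) (tail M y)) \<le> C * nrm (lp p) x * nrm (lp q) y"
    if "x \<in> carr (lp p)" "y \<in> carr (lp q)" for x y
  proof -
    have "norm (A (tail N x) (tail M y)) \<le> C * nrm (lp p) (tail N x) * nrm (lp q) (tail M y)"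
      using that by (intro C carr_tail)
    also have "\<dots> \<le> C * nrm (lp p) x * nrm (lp q) y"
      using C(1) that pq by (intro mult_mono nrm_tail_le) auto
    finally show ?thesis .
  qed
  then show ?thesis
    by (intro bounded_bilinear_formsI[where C = C])
      (simp_all add: tail_add tail_scale form_add_left[OF A] form_add_right[OF A]
        form_scale_left[OF A] form_scale_right[OF A])
qed

lemma form_tail_left:
  assumes "A \<in> bounded_bilinear_forms (lp p) (lp q)" "0 < p" "0 < q"
  shows "(\<lambda>x y. A (tail N x) y) \<in> bounded_bilinear_forms (lp p) (lp q)"
  using form_tail[OF assms, of N 0] by (simp add: tail_def)

text \<open>Here \<open>P K\<close> will say that \<open>K\<close> bounds the form on some tail. If
  passing further out always improves a bound by the factor \<open>c < 1\<close>, then iteration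
  reaches every positive bound.\<close>

lemma small_of_contraction:
  fixes P :: "real \<Rightarrow> bool"
  assumes "P K" "0 \<le> K" "0 \<le> c" "c < 1" "0 < e"
    and step: "\<And>K. 0 \<le> K \<Longrightarrow> P K \<Longrightarrow> P (c * K)"
    and mono: "\<And>K L. P K \<Longrightarrow> K \<le> L \<Longrightarrow> P L"
  shows "P e"
proof -
  have "P (c ^ n * K)" for n
    by (induction n) (use assms step[of "c ^ _ * K"] in \<open>auto simp: mult.assoc\<close>)
  moreover have "(\<lambda>n. c ^ n * K) \<longlonglongrightarrow> 0"
    using assms by (intro tendsto_mult_left_zero LIMSEQ_realpow_zero)
  then have "eventually (\<lambda>n. c ^ n * K < e) sequentially"
    using \<open>0 < e\<close> by (rule order_tendstoD)
  then obtain n where "c ^ n * K < e"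
    by (auto simp only: eventually_sequentially)
  ultimately show ?thesis
    using mono by (meson less_imp_le)
qed

lemma nrm_disjoint_le_2:
  assumes "x \<in> carr (lp p)" "y \<in> carr (lp p)" "\<And>n. x n = 0 \<or> y n = 0" "0 < p"
    and "nrm (lp p) x \<le> 1" "nrm (lp p) y \<le> 1"
  shows "nrm (lp p) (\<lambda>n. x n + y n) \<le> 2 powr (1 / p)"
  using nrm_disjoint_le[OF assms] by simp

lemma nrm_uminus [simp]: "nrm (lp p) (\<lambda>n. - x n) = nrm (lp p) x"
  by (simp add: nrm_lp)

text \<open>
  If \<open>A\<close> exceeds \<open>c * K\<close> at some pair of finitely supported vectors, then its values further out
  are at most \<open>c * K\<close>, since both contributions add up on vectors of norms at most
  \<open>2 powr (1/p)\<close> and \<open>2 powr (1/q)\<close>.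
\<close>

lemma form_tail_tail_small:
  assumes A: "A \<in> bounded_bilinear_forms (lp p) (lp q)" and p: "0 < p" and q: "0 < q"
    and pq: "1 / p + 1 / q < 1" and e: "0 < e"
  shows "\<exists>N. \<forall>x\<in>carr (lp p). \<forall>y\<in>carr (lp q).
    norm (A (tail N x) (tail N y)) \<le> e * nrm (lp p) x * nrm (lp q) y"
proof -
  define P where "P K \<longleftrightarrow> (\<exists>N. \<forall>x\<in>carr (lp p). \<forall>y\<in>carr (lp q).
    norm (A (tail N x) (tail N y)) \<le> K * nrm (lp p) x * nrm (lp q) y)" for K
  \<comment> \<open>Two blocks double the value, while the norms grow by
    \<open>2 powr (1 / p)\<close> and \<open>2 powr (1 / q)\<close>; the hypothesis on the exponents
    says exactly that \<open>c < 1\<close>.\<close>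
  define c :: real where "c = 2 powr (1 / p + 1 / q) / 2"
  have c: "0 \<le> c" "c < 1"
    using powr_less_mono[OF pq, of 2] by (auto simp: c_def)
  have PI: "P K" if "\<And>x y. x \<in> usphere (lp p) \<Longrightarrow> y \<in> usphere (lp q) \<Longrightarrow>
      norm (A (tail N x) (tail N y)) \<le> K" for K N
    unfolding P_def
    using form_le_of_usphere[OF form_tail[OF A p q, of N N] p q that] by (intro exI[of _ N]) blast
  have step: "P (c * K)" if K: "0 \<le> K" and PK: "P K" for K
  proof -
    obtain N where N: "\<And>x y. x \<in> carr (lp p) \<Longrightarrow> y \<in> carr (lp q) \<Longrightarrow>
        norm (A (tail N x) (tail N y)) \<le> K * nrm (lp p) x * nrm (lp q) y"
      using PK unfolding P_def by blast
    show ?thesis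
    proof (cases "\<exists>x\<in>usphere (lp p). \<exists>y\<in>usphere (lp q). c * K < norm (A (tail N x) (tail N y))")
      case True
      then obtain x y where xy: "x \<in> usphere (lp p)" "y \<in> usphere (lp q)"
        and gt: "c * K < norm (A (tail N x) (tail N y))" by blast
      have carr: "tail N x \<in> carr (lp p)" "tail N y \<in> carr (lp q)"
        using xy by (auto dest: usphere_lpD)
      \<comment> \<open>The strict inequality survives cutting both vectors to finite support, which
        leaves room for disjoint vectors beyond \<open>M\<close>.\<close>
      have "(\<lambda>M. norm (A (initial M (tail N x)) (initial M (tail N y)))) \<longlonglongrightarrow> norm (A (tail N x) (tail N y))"
        by (rule tendsto_norm[OF form_initial_tendsto[OF A p q carr]])
      then have "\<forall>\<^sub>F M in sequentially. c * K < norm (A (initial M (tail N x)) (initial M (tail N y)))"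
        using gt by (rule order_tendstoD)
      then obtain M0 where M0: "\<forall>M\<ge>M0. c * K < norm (A (initial M (tail N x)) (initial M (tail N y)))"
        by (auto simp only: eventually_sequentially)
      define M where "M = max N M0"
      have M: "N \<le> M" "c * K < norm (A (initial M (tail N x)) (initial M (tail N y)))"
        using M0 by (auto simp: M_def)
      define a b where "a = initial M (tail N x)" and "b = initial M (tail N y)"
      have ab: "a \<in> carr (lp p)" "b \<in> carr (lp q)" "nrm (lp p) a \<le> 1" "nrm (lp q) b \<le> 1"
        using nrm_initial_le[OF carr(1) p, of M] nrm_tail_le[OF usphere_lpD(1)[OF xy(1)] p, of N]
          nrm_initial_le[OF carr(2) q, of M] nrm_tail_le[OF usphere_lpD(1)[OF xy(2)] q, of N]
          usphere_lpD(2)[OF xy(1)] usphere_lpD(2)[OF xy(2)]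
        by (auto simp: a_def b_def)
      show ?thesis
      proof (rule PI)
        fix u v :: "nat \<Rightarrow> 'a" assume "u \<in> usphere (lp p)" "v \<in> usphere (lp q)"
        then have uv: "u \<in> carr (lp p)" "v \<in> carr (lp q)" "nrm (lp p) u = 1" "nrm (lp q) v = 1"
          by (auto dest: usphere_lpD)
        define a' b' where "a' = tail M u" and "b' = tail M v"
        have ab': "a' \<in> carr (lp p)" "b' \<in> carr (lp q)" "nrm (lp p) a' \<le> 1" "nrm (lp q) b' \<le> 1"
          using nrm_tail_le[OF uv(1) p, of M] nrm_tail_le[OF uv(2) q, of M] uv
          by (auto simp: a'_def b'_def)
        obtain k where k: "norm k = 1" "2 * (norm (A a b) + norm (A a' b')) \<le>
            norm (A (\<lambda>n. a n + a' n) (\<lambda>n. b n + k * b' n)) +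
            norm (A (\<lambda>n. a n + - a' n) (\<lambda>n. b n + - (k * b' n)))"
          using form_sign_average[OF A p q ab(1) ab'(1) ab(2) ab'(2)] by blast
        have *: "norm (A (\<lambda>n. a n + s n) (\<lambda>n. b n + t n)) \<le> 2 * (c * K)"
          if st: "s \<in> carr (lp p)" "t \<in> carr (lp q)" "nrm (lp p) s \<le> 1" "nrm (lp q) t \<le> 1"
            "\<And>n. n < M \<Longrightarrow> s n = 0" "\<And>n. n < M \<Longrightarrow> t n = 0" for s t
        proof -
          \<comment> \<open>The sums still live beyond \<open>N\<close>, so the old bound
            \<open>K\<close> applies to them.\<close>
          have tl: "(\<lambda>n. a n + s n) = tail N (\<lambda>n. a n + s n)" "(\<lambda>n. b n + t n) = tail N (\<lambda>n. b n + t n)"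
            using M(1) st by (auto simp: a_def b_def tail_def initial_def)
          have n: "nrm (lp p) (\<lambda>n. a n + s n) \<le> 2 powr (1 / p)" "nrm (lp q) (\<lambda>n. b n + t n) \<le> 2 powr (1 / q)"
            by (rule nrm_disjoint_le_2; use ab st p q in \<open>force simp: a_def b_def initial_def\<close>)+
          have "norm (A (\<lambda>n. a n + s n) (\<lambda>n. b n + t n)) \<le>
              K * nrm (lp p) (\<lambda>n. a n + s n) * nrm (lp q) (\<lambda>n. b n + t n)"
            using N[of "\<lambda>n. a n + s n" "\<lambda>n. b n + t n"] ab st p q tl by simp
          also have "\<dots> \<le> K * 2 powr (1 / p) * 2 powr (1 / q)"
            using n K by (intro mult_mono) auto
          finally show ?thesis
            by (simp add: c_def powr_add mult_ac)
        qed
        have "norm (A (\<lambda>n. a n + a' n) (\<lambda>n. b n + k * b' n)) \<le> 2 * (c * K)"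
          using ab' k(1) q by (intro *) (auto simp: nrm_scale, auto simp: a'_def b'_def tail_def)
        moreover have "norm (A (\<lambda>n. a n + - a' n) (\<lambda>n. b n + - (k * b' n))) \<le> 2 * (c * K)"
          using ab' k(1) q by (intro *) (auto simp: nrm_scale, auto simp: a'_def b'_def tail_def)
        \<comment> \<open>Twice the sum is at most \<open>4 * (c * K)\<close>, and the first summand
          alone exceeds \<open>c * K\<close>; this leaves at most \<open>c * K\<close> for the
          second.\<close>
        ultimately have "2 * (norm (A a b) + norm (A a' b')) \<le> 2 * (c * K) + 2 * (c * K)"
          by (intro order_trans[OF k(2)] add_mono)
        then show "norm (A (tail M u) (tail M v)) \<le> c * K"
          using M(2) unfolding a_def b_def a'_def b'_def by argo
      qed
    next
      case False
      then show ?thesis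
        by (intro PI[of N]) (auto simp: not_less)
    qed
  qed
  have mono: "P L" if "P K" "K \<le> L" for K L
  proof -
    have "K * nrm (lp p) x * nrm (lp q) y \<le> L * nrm (lp p) x * nrm (lp q) y" for x y :: "nat \<Rightarrow> 'a"
      using that by (intro mult_right_mono) auto
    then show ?thesis
      using that unfolding P_def by (meson order_trans)
  qed
  \<comment> \<open>The iteration starts at cutoff 0, where \<open>tail 0\<close> is the
    identity.\<close>
  have "P (max 0 (form_norm (lp p) (lp q) A))"
    by (rule PI[of 0]) (auto simp: tail_def le_max_iff_disj intro!: disjI2 le_form_norm A)
  then have "P e"
    by (rule small_of_contraction[where c = c]) (use c e step mono in auto)
  then show ?thesis
    by (simp add: P_def)
qed

text \<open>For fixed \<open>y\<close> this is a bounded functional on \<open>lp p\<close>, and for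
  \<open>p > 1\<close> its tails vanish in norm. The doubling argument in one argument proves it
  without duality: two blocks double the value but multiply the norm by only
  \<open>2 powr (1 / p) < 2\<close>.\<close>

lemma form_tail_left_at_small:
  assumes A: "A \<in> bounded_bilinear_forms (lp p) (lp q)" and p: "1 < p" and q: "0 < q"
    and y: "y \<in> carr (lp q)" and e: "0 < e"
  shows "\<exists>N. \<forall>x\<in>carr (lp p). norm (A (tail N x) y) \<le> e * nrm (lp p) x"
proof -
  have p': "0 < p" using p by simp
  define P where "P K \<longleftrightarrow> (\<exists>N. \<forall>x\<in>carr (lp p). norm (A (tail N x) y) \<le> K * nrm (lp p) x)" for K
  define c :: real where "c = 2 powr (1 / p) / 2"
  have c: "0 \<le> c" "c < 1"
    using powr_less_mono[of "1 / p" 1 2] p by (auto simp: c_def)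
  obtain C where C: "0 \<le> C" "\<And>x y. x \<in> carr (lp p) \<Longrightarrow> y \<in> carr (lp q) \<Longrightarrow>
       norm (A x y) \<le> C * nrm (lp p) x * nrm (lp q) y"
    using form_bounded[OF A] nrm_nonneg by metis
  have PI: "P K" if "\<And>x. x \<in> usphere (lp p) \<Longrightarrow> norm (A (tail N x) y) \<le> K" for K N
    unfolding P_def
    using form_left_le_of_usphere[OF form_tail_left[OF A p' q, of N] p' y that]
    by (intro exI[of _ N]) blast
  have step: "P (c * K)" if K: "0 \<le> K" and PK: "P K" for K
  proof -
    obtain N where N: "\<And>x. x \<in> carr (lp p) \<Longrightarrow> norm (A (tail N x) y) \<le> K * nrm (lp p) x"
      using PK unfolding P_def by blast
    show ?thesis
    proof (cases "\<exists>x\<in>usphere (lp p). c * K < norm (A (tail N x) y)")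
      case True
      then obtain x where x: "x \<in> usphere (lp p)" and gt: "c * K < norm (A (tail N x) y)" by blast
      have xc: "x \<in> carr (lp p)" "tail N x \<in> carr (lp p)"
        using x by (auto dest: usphere_lpD)
      \<comment> \<open>Cutting \<open>tail N x\<close> at \<open>M\<close> changes the value by at
        most this quantity, so for large \<open>M\<close> the finitely supported part still exceeds
        \<open>c * K\<close>.\<close>
      have "(\<lambda>M. C * nrm (lp p) (tail M (tail N x)) * nrm (lp q) y) \<longlonglongrightarrow> C * 0 * nrm (lp q) y"
        by (intro tendsto_mult tendsto_const nrm_tail_tendsto xc p')
      then have "(\<lambda>M. norm (A (tail N x) y) - C * nrm (lp p) (tail M (tail N x)) * nrm (lp q) y)
          \<longlonglongrightarrow> norm (A (tail N x) y) - 0"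
        by (intro tendsto_diff tendsto_const) simp
      then have "\<forall>\<^sub>F M in sequentially.
          c * K < norm (A (tail N x) y) - C * nrm (lp p) (tail M (tail N x)) * nrm (lp q) y"
        using gt by (intro order_tendstoD) auto
      then obtain M0 where M0: "\<forall>M\<ge>M0.
          c * K < norm (A (tail N x) y) - C * nrm (lp p) (tail M (tail N x)) * nrm (lp q) y"
        by (auto simp only: eventually_sequentially)
      define M where "M = max N M0"
      have M: "N \<le> M"
        "c * K < norm (A (tail N x) y) - C * nrm (lp p) (tail M (tail N x)) * nrm (lp q) y"
        using M0 by (auto simp: M_def)
      define a where "a = initial M (tail N x)"
      have a: "a \<in> carr (lp p)" "nrm (lp p) a \<le> 1"
        using nrm_initial_le[OF xc(2) p', of M] nrm_tail_le[OF xc(1) p', of N] usphere_lpD(2)[OF x]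
        by (auto simp: a_def)
      have split: "A (tail N x) y = A a y + A (tail M (tail N x)) y"
        unfolding a_def using form_truncate_left[OF A p' xc(2) y] .
      then have gta: "c * K < norm (A a y)"
        using M(2) C(2)[OF carr_tail[OF xc(2)] y, of M]
          norm_triangle_ineq[of "A a y" "A (tail M (tail N x)) y"] unfolding split by linarith
      show ?thesis
      proof (rule PI)
        fix u :: "nat \<Rightarrow> 'a" assume "u \<in> usphere (lp p)"
        then have u: "u \<in> carr (lp p)" "nrm (lp p) u = 1"
          by (auto dest: usphere_lpD)
        obtain k where k: "norm k = 1"
          "norm (A a y + k * A (tail M u) y) = norm (A a y) + norm (A (tail M u) y)"
          using exists_phase[of "A a y" "A (tail M u) y"] by blast
        have ku: "(\<lambda>n. k * tail M u n) \<in> carr (lp p)" "nrm (lp p) (\<lambda>n. k * tail M u n) \<le> 1"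
          using nrm_tail_le[OF u(1) p', of M] u k(1) p' by (auto simp: nrm_scale)
        have tl: "(\<lambda>n. a n + k * tail M u n) = tail N (\<lambda>n. a n + k * tail M u n)"
          using M(1) by (auto simp: a_def tail_def initial_def)
        have "norm (A a y) + norm (A (tail M u) y) = norm (A (\<lambda>n. a n + k * tail M u n) y)"
          using form_add_left[OF A a(1) ku(1) y] form_scale_left[OF A carr_tail[OF u(1)] y, of k M] k(2)
          by simp
        also have "\<dots> \<le> K * nrm (lp p) (\<lambda>n. a n + k * tail M u n)"
          using N[of "\<lambda>n. a n + k * tail M u n"] a ku p' tl by simp
        also have "\<dots> \<le> K * 2 powr (1 / p)"
          by (intro mult_left_mono nrm_disjoint_le_2 a ku p' K)
            (auto simp: a_def tail_def initial_def)
        finally show "norm (A (tail M u) y) \<le> c * K"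
          using gta by (simp add: c_def field_simps)
      qed
    next
      case False
      then show ?thesis
        by (intro PI[of N]) (auto simp: not_less)
    qed
  qed
  have mono: "P L" if "P K" "K \<le> L" for K L
  proof -
    have "K * nrm (lp p) x \<le> L * nrm (lp p) x" for x :: "nat \<Rightarrow> 'a"
      using that by (intro mult_right_mono) auto
    then show ?thesis
      using that unfolding P_def by (meson order_trans)
  qed
  have "P (C * nrm (lp q) y)"
    unfolding P_def using C(2)[OF _ y] by (intro exI[of _ 0]) (auto simp: tail_def mult_ac)
  then have "P e"
    by (rule small_of_contraction[where c = c]) (use c e step mono C in auto)
  then show ?thesis
    by (simp add: P_def)
qed

text \<open>Split \<open>y\<close> at \<open>M\<close>. Beyond \<open>M\<close> the estimate for two
  tails applies; before \<open>M\<close> only the finitely many functionals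
  \<open>A _ (unit_seq j)\<close> matter, and each of them has small tails.\<close>

lemma form_tail_left_small:
  assumes A: "A \<in> bounded_bilinear_forms (lp p) (lp q)" and p: "1 < p" and q: "1 < q"
    and pq: "1 / p + 1 / q < 1" and e: "0 < e"
  shows "\<exists>N. \<forall>x\<in>carr (lp p). \<forall>y\<in>carr (lp q).
    norm (A (tail N x) y) \<le> e * nrm (lp p) x * nrm (lp q) y"
proof -
  have p': "0 < p" and q': "0 < q" using p q by auto
  obtain M where M: "\<And>x y. x \<in> carr (lp p) \<Longrightarrow> y \<in> carr (lp q) \<Longrightarrow>
      norm (A (tail M x) (tail M y)) \<le> e / 2 * nrm (lp p) x * nrm (lp q) y"
    using form_tail_tail_small[OF A p' q' pq, of "e / 2"] e by auto
  \<comment> \<open>The \<open>M\<close> coordinates may contribute \<open>e / 2\<close> in total;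
    the \<open>+ 1\<close> covers \<open>M = 0\<close>.\<close>
  define d where "d = e / (2 * (real M + 1))"
  have d: "0 < d" "real M * d \<le> e / 2"
    using e by (auto simp: d_def field_simps)
  have "\<exists>N. \<forall>x\<in>carr (lp p). norm (A (tail N x) (unit_seq j)) \<le> d * nrm (lp p) x" for j
    by (rule form_tail_left_at_small[OF A p q' carr_unit_seq d(1)])
  then obtain f where f: "\<And>j x. x \<in> carr (lp p) \<Longrightarrow> norm (A (tail (f j) x) (unit_seq j)) \<le> d * nrm (lp p) x"
    by metis
  \<comment> \<open>The sum is a convenient natural number above \<open>M\<close> and above every
    \<open>f j\<close> with \<open>j < M\<close>.\<close>
  define N where "N = M + (\<Sum>j<M. f j)"
  have N: "f j \<le> N" if "j < M" for j
    unfolding N_def using that member_le_sum[of j "{..<M}" f] by simp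
  have "norm (A (tail N x) y) \<le> e * nrm (lp p) x * nrm (lp q) y"
    if x: "x \<in> carr (lp p)" and y: "y \<in> carr (lp q)" for x y
  proof -
    have tx: "tail N x \<in> carr (lp p)" using x by simp
    have "norm (y j * A (tail N x) (unit_seq j)) \<le> nrm (lp q) y * (d * nrm (lp p) x)" if "j < M" for j
    proof -
      have "norm (A (tail (f j) (tail N x)) (unit_seq j)) \<le> d * nrm (lp p) (tail N x)"
        by (rule f[OF tx])
      also have "\<dots> \<le> d * nrm (lp p) x"
        using d x p' by (intro mult_left_mono nrm_tail_le) auto
      finally show ?thesis
        using norm_le_nrm[OF y q', of j] tail_tail[OF N[OF that], of x]
        by (simp add: norm_mult mult_mono)
    qed
    then have "norm (\<Sum>j<M. y j * A (tail N x) (unit_seq j)) \<le> (\<Sum>j<M. nrm (lp q) y * (d * nrm (lp p) x))"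
      by (intro sum_norm_le) auto
    also have "\<dots> = (real M * d) * (nrm (lp p) x * nrm (lp q) y)"
      by simp
    also have "\<dots> \<le> e / 2 * (nrm (lp p) x * nrm (lp q) y)"
      by (intro mult_right_mono d) simp
    finally have 1: "norm (A (tail N x) (initial M y)) \<le> e / 2 * nrm (lp p) x * nrm (lp q) y"
      using form_initial_right[OF A q' tx, of M y] by simp
    have "norm (A (tail M (tail N x)) (tail M y)) \<le> e / 2 * nrm (lp p) (tail N x) * nrm (lp q) y"
      by (rule M[OF tx y])
    also have "\<dots> \<le> e / 2 * nrm (lp p) x * nrm (lp q) y"
      using e x p' by (intro mult_right_mono mult_left_mono nrm_tail_le) auto
    finally have 2: "norm (A (tail N x) (tail M y)) \<le> e / 2 * nrm (lp p) x * nrm (lp q) y"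
      by (simp add: tail_tail N_def)
    show ?thesis
      using 1 2 form_truncate_right[OF A q' tx y, of M]
        norm_triangle_ineq[of "A (tail N x) (initial M y)" "A (tail N x) (tail M y)"] by simp
  qed
  then show ?thesis by blast
qed

subsection \<open>Smoothness of \<open>\<ell>\<^sub>q\<close> for \<open>q \<ge> 2\<close>\<close>

lemma exp_le_quadratic:
  fixes u :: real
  assumes "\<bar>u\<bar> \<le> 1"
  shows "exp u \<le> 1 + u + u\<^sup>2"
proof (cases "0 \<le> u")
  case True
  then show ?thesis using assms by (intro exp_bound) auto
next
  case False
  define v where "v = - u"
  have v: "0 \<le> v" using False by (simp add: v_def)
  \<comment> \<open>For \<open>u = - v\<close> the claim reads
    \<open>1 \<le> (1 - v + v^2) * exp v\<close>, which follows from
    \<open>1 + v \<le> exp v\<close> and this factorization.\<close>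
  have "1 \<le> 1 + v ^ 3"
    using v by simp
  also have "\<dots> = (1 - v + v\<^sup>2) * (1 + v)"
    by (simp add: algebra_simps power2_eq_square power3_eq_cube)
  also have "\<dots> \<le> (1 - v + v\<^sup>2) * exp v"
  proof (rule mult_left_mono)
    have "0 \<le> (1 - v / 2)\<^sup>2 + 3 / 4 * v\<^sup>2" by simp
    then show "0 \<le> 1 - v + v\<^sup>2" by (simp add: power2_eq_square algebra_simps)
  qed simp
  finally have "inverse (exp v) \<le> 1 - v + v\<^sup>2"
    by (simp add: field_simps)
  then show ?thesis by (simp add: v_def exp_minus[of u])
qed

text \<open>Write the squared norms of \<open>1 + w\<close> and \<open>1 - w\<close> as
  \<open>1 + s\<close> and \<open>1 + t\<close>. The parts of \<open>s\<close> and \<open>t\<close>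
  linear in \<open>w\<close> are opposite and cancel in the sum. Each power is at most
  \<open>exp (r * h) \<le> 1 + r * h + (r * h)^2\<close> with \<open>h\<close> equal to
  \<open>s\<close> or \<open>t\<close>; since \<open>\<bar>h\<bar> \<le> 3 * norm w\<close>, the
  bound on \<open>w\<close> gives \<open>\<bar>r * h\<bar> \<le> 1\<close>, and the two squares give
  \<open>18 = 2 * 9\<close>.\<close>

lemma powr_norm_parallelogram_one:
  fixes w :: "'k::{real_normed_field,euclidean_space}"
  assumes r: "1 \<le> r" and w: "norm w \<le> 1 / (3 * r)"
  shows "norm (1 + w) powr (2 * r) + norm (1 - w) powr (2 * r) \<le> 2 + (2 * r + 18 * r\<^sup>2) * (norm w)\<^sup>2"
proof -
  define \<beta> where "\<beta> = 2 * inner 1 w"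
  define s where "s = (norm w)\<^sup>2 + \<beta>"
  define t where "t = (norm w)\<^sup>2 - \<beta>"
  have "1 / (3 * r) \<le> 1" using r by (simp add: field_simps)
  then have w1: "norm w \<le> 1" using w by linarith
  have \<beta>: "\<bar>\<beta>\<bar> \<le> 2 * norm w"
    using Cauchy_Schwarz_ineq2[of 1 w] by (simp add: \<beta>_def)
  have "(norm w)\<^sup>2 \<le> norm w"
    using w1 by (simp add: power2_eq_square mult_left_le)
  then have st: "\<bar>s\<bar> \<le> 3 * norm w" "\<bar>t\<bar> \<le> 3 * norm w"
    using \<beta> zero_le_power2[of "norm w"] unfolding s_def t_def by linarith+
  have n: "(norm (1 + w))\<^sup>2 = 1 + s" "(norm (1 - w))\<^sup>2 = 1 + t"
    by (simp_all add: s_def t_def \<beta>_def power2_norm_eq_inner inner_add_left inner_add_right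
        inner_diff_left inner_diff_right inner_commute norm_eq_1[symmetric])
  have *: "norm z powr (2 * r) \<le> 1 + r * h + 9 * r\<^sup>2 * (norm w)\<^sup>2"
    if z: "(norm z)\<^sup>2 = 1 + h" and h: "\<bar>h\<bar> \<le> 3 * norm w" for z :: 'k and h
  proof -
    have "norm z powr (2 * r) = (norm z powr 2) powr r"
      by (simp only: powr_powr)
    also have "\<dots> = (1 + h) powr r"
      using z by simp
    also have "\<dots> \<le> exp h powr r"
      using r z zero_le_power2[of "norm z"] by (intro powr_mono2) auto
    also have "\<dots> = exp (r * h)"
      by (simp add: powr_def mult.commute)
    also have "\<dots> \<le> 1 + r * h + (r * h)\<^sup>2"
    proof (rule exp_le_quadratic)
      have "\<bar>r * h\<bar> \<le> r * (3 * norm w)"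
        using r h by (simp add: abs_mult)
      also have "\<dots> \<le> 1"
        using r w by (simp add: field_simps)
      finally show "\<bar>r * h\<bar> \<le> 1" .
    qed
    also have "(r * h)\<^sup>2 \<le> 9 * r\<^sup>2 * (norm w)\<^sup>2"
    proof -
      have "\<bar>r * h\<bar>\<^sup>2 \<le> (r * (3 * norm w))\<^sup>2"
        using r h by (intro power_mono) (auto simp: abs_mult)
      then show ?thesis by (simp add: power_mult_distrib)
    qed
    finally show ?thesis by simp
  qed
  have "r * s + r * t = 2 * r * (norm w)\<^sup>2"
    by (simp add: s_def t_def algebra_simps)
  then show ?thesis
    using *[OF n(1) st(1)] *[OF n(2) st(2)] by (simp add: algebra_simps)
qed

lemma powr_norm_parallelogram:
  assumes q: "2 \<le> q"
  shows "\<exists>C\<ge>0. \<forall>(a::'k::{real_normed_field,euclidean_space}) b s. 0 \<le> s \<longrightarrow> s \<le> 1 \<longrightarrow>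
    norm (a + of_real s * b) powr q + norm (a - of_real s * b) powr q \<le>
      2 * norm a powr q + C * s\<^sup>2 * (norm a powr q + norm b powr q)"
proof -
  define r where "r = q / 2"
  have r: "1 \<le> r" "q = 2 * r" using q by (auto simp: r_def)
  define C1 where "C1 = 2 * r + 18 * r\<^sup>2"
  define C2 where "C2 = 2 * (3 * r + 1) powr q"
  have C: "0 \<le> C1" "0 \<le> C2" using r by (auto simp: C1_def C2_def)
  have "norm (a + of_real s * b) powr q + norm (a - of_real s * b) powr q \<le>
      2 * norm a powr q + (C1 + C2) * s\<^sup>2 * (norm a powr q + norm b powr q)"
    if s: "0 \<le> s" "s \<le> 1" for a b :: 'k and s
  \<comment> \<open>For a relatively small perturbation, dividing by \<open>a\<close> reduces to
    base point 1.\<close>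
  proof (cases "a \<noteq> 0 \<and> norm (of_real s * b) \<le> norm a / (3 * r)")
    case True
    define w where "w = of_real s * b / a"
    have nw: "norm w = s * norm b / norm a"
      using s by (simp add: w_def norm_mult norm_divide)
    have w: "norm w \<le> 1 / (3 * r)"
      using True s r by (simp add: nw norm_mult field_simps)
    have eq: "a + of_real s * b = a * (1 + w)" "a - of_real s * b = a * (1 - w)"
      using True by (auto simp: w_def field_simps)
    have "norm (a + of_real s * b) powr q + norm (a - of_real s * b) powr q =
        norm a powr q * (norm (1 + w) powr q + norm (1 - w) powr q)"
      unfolding eq norm_mult powr_mult by (simp add: algebra_simps)
    also have "\<dots> \<le> norm a powr q * (2 + C1 * (norm w)\<^sup>2)"
      using powr_norm_parallelogram_one[OF r(1) w] by (intro mult_left_mono) (auto simp: r(2) C1_def)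
    also have "\<dots> = 2 * norm a powr q + C1 * s\<^sup>2 * (norm a powr (q - 2) * (norm b)\<^sup>2)"
      using True by (simp add: nw powr_diff power_divide power_mult_distrib field_simps)
    also have "norm a powr (q - 2) * (norm b)\<^sup>2 \<le> norm a powr q + norm b powr q"
    proof -
      define m where "m = max (norm a) (norm b)"
      have m: "0 < m" using True by (simp add: m_def less_max_iff_disj)
      have "norm a powr (q - 2) * (norm b)\<^sup>2 \<le> m powr (q - 2) * m\<^sup>2"
        using q by (intro mult_mono powr_mono2 power_mono) (auto simp: m_def)
      also have "\<dots> = m powr q"
        using m by (simp add: powr_diff)
      also have "\<dots> \<le> norm a powr q + norm b powr q"
        by (auto simp: m_def max_def)
      finally show ?thesis .
    qed
    also have "2 * norm a powr q + C1 * s\<^sup>2 * (norm a powr q + norm b powr q) \<le>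
        2 * norm a powr q + (C1 + C2) * s\<^sup>2 * (norm a powr q + norm b powr q)"
      using C by (intro add_left_mono mult_right_mono) auto
    finally show ?thesis
      using C by (simp add: mult_left_mono)
  next
    case False
    \<comment> \<open>Now \<open>a\<close> is itself of order \<open>s * norm b\<close>, so both
      powers are of order \<open>s powr q\<close>, which is at most \<open>s powr 2\<close> because
      \<open>q \<ge> 2\<close> and \<open>s \<le> 1\<close>.\<close>
    then have na: "norm a \<le> 3 * r * (s * norm b)"
      using r s by (auto simp: norm_mult field_simps)
    have *: "norm z powr q \<le> (3 * r + 1) powr q * (s\<^sup>2 * norm b powr q)"
      if z: "norm z \<le> norm a + s * norm b" for z :: 'k
    proof -
      have "norm z \<le> (3 * r + 1) * s * norm b"
        using z na by (simp add: algebra_simps)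
      then have "norm z powr q \<le> ((3 * r + 1) * s * norm b) powr q"
        using q by (intro powr_mono2) auto
      also have "\<dots> = (3 * r + 1) powr q * (s powr q * norm b powr q)"
        by (simp add: powr_mult)
      also have "s powr q \<le> s powr 2"
        using s q by (intro powr_mono') auto
      finally show ?thesis
        using s by (simp add: mult_left_mono mult_right_mono)
    qed
    have "norm (a + of_real s * b) powr q + norm (a - of_real s * b) powr q \<le> C2 * (s\<^sup>2 * norm b powr q)"
      using *[of "a + of_real s * b"] *[of "a - of_real s * b"] s
        norm_triangle_ineq[of a "of_real s * b"] norm_triangle_ineq4[of a "of_real s * b"]
      by (simp add: C2_def norm_mult)
    also have "\<dots> \<le> (C1 + C2) * (s\<^sup>2 * (norm a powr q + norm b powr q))"
      using C by (intro mult_mono) auto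
    finally have "norm (a + of_real s * b) powr q + norm (a - of_real s * b) powr q
        \<le> (C1 + C2) * (s\<^sup>2 * (norm a powr q + norm b powr q))" .
    moreover have "0 \<le> 2 * norm a powr q" by simp
    ultimately show ?thesis unfolding mult.assoc by linarith
  qed
  then show ?thesis using C by (intro exI[of _ "C1 + C2"]) auto
qed

text \<open>The tangent at 1 lies above the concave function. It turns a bound on the sum of two
  \<open>q\<close>-th powers into one on the sum of the norms and keeps the order \<open>s^2\<close>
  of the error.\<close>

lemma powr_inverse_le_tangent:
  fixes t :: real
  assumes "0 \<le> t" "1 \<le> q"
  shows "t powr (1 / q) \<le> 1 + (t - 1) / q"
proof (cases "t = 0")
  case True
  then show ?thesis using assms by (simp add: field_simps)
next
  case False
  then show ?thesis
    using Youngs_inequality_0[of "1 / q" "1 - 1 / q" t 1] assms by (simp add: field_simps)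
qed

text \<open>For \<open>q \<ge> 2\<close> the modulus of smoothness has power type 2. The scalar
  inequality is summed over the coordinates; \<open>D\<close> is uniform in \<open>y\<close> and
  \<open>v\<close>.\<close>

lemma nrm_parallelogram:
  assumes q: "2 \<le> q"
  shows "\<exists>D\<ge>0. \<forall>(y::nat \<Rightarrow> 'k::{real_normed_field,euclidean_space})\<in>carr (lp q). \<forall>v\<in>carr (lp q). \<forall>s.
    nrm (lp q) y \<le> 1 \<longrightarrow> nrm (lp q) v \<le> 1 \<longrightarrow> 0 \<le> s \<longrightarrow> s \<le> 1 \<longrightarrow>
    nrm (lp q) (\<lambda>n. y n + of_real s * v n) + nrm (lp q) (\<lambda>n. y n - of_real s * v n) \<le> 2 + D * s\<^sup>2"
proof -
  obtain C where C: "0 \<le> C" "\<And>(a::'k) b s. 0 \<le> s \<Longrightarrow> s \<le> 1 \<Longrightarrow>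
    norm (a + of_real s * b) powr q + norm (a - of_real s * b) powr q \<le>
      2 * norm a powr q + C * s\<^sup>2 * (norm a powr q + norm b powr q)"
    using powr_norm_parallelogram[OF q, where 'k = 'k] by blast
  have q0: "0 < q" using q by simp
  have "nrm (lp q) (\<lambda>n. y n + of_real s * v n) + nrm (lp q) (\<lambda>n. y n - of_real s * v n) \<le> 2 + 2 * C / q * s\<^sup>2"
    if y: "y \<in> carr (lp q)" "nrm (lp q) y \<le> 1" and v: "v \<in> carr (lp q)" "nrm (lp q) v \<le> 1"
      and s: "0 \<le> s" "s \<le> 1" for y v :: "nat \<Rightarrow> 'k" and s
  proof -
    define P where "P = (\<lambda>n. y n + of_real s * v n)"
    define M where "M = (\<lambda>n. y n - of_real s * v n)"
    have PM: "P \<in> carr (lp q)" "M \<in> carr (lp q)"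
      unfolding P_def M_def by (intro carr_add carr_diff carr_scale y v q0)+
    have "lp_sum q y \<le> 1" "lp_sum q v \<le> 1"
      using y v q0 by (auto simp flip: nrm_powr intro!: powr_le1)
    have "lp_sum q P + lp_sum q M = (\<Sum>n. norm (P n) powr q + norm (M n) powr q)"
      using PM by (simp add: lp_sum_def carr_lp suminf_add)
    also have "\<dots> \<le> (\<Sum>n. 2 * norm (y n) powr q + C * s\<^sup>2 * (norm (y n) powr q + norm (v n) powr q))"
      using PM y v C(2)[OF s] unfolding carr_lp
      by (intro suminf_le summable_add summable_mult) (auto simp: P_def M_def)
    also have "\<dots> = 2 * lp_sum q y + C * s\<^sup>2 * (lp_sum q y + lp_sum q v)"
      using y(1) v(1) unfolding carr_lp lp_sum_def
      by (subst suminf_add[symmetric]) (auto simp: suminf_add suminf_mult summable_add summable_mult)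
    also have "\<dots> \<le> 2 * 1 + C * s\<^sup>2 * (1 + 1)"
      using \<open>lp_sum q y \<le> 1\<close> \<open>lp_sum q v \<le> 1\<close> C(1)
      by (intro add_mono mult_left_mono) auto
    finally have le: "lp_sum q P + lp_sum q M \<le> 2 + 2 * C * s\<^sup>2"
      by simp
    have "nrm (lp q) P + nrm (lp q) M \<le> (1 + (lp_sum q P - 1) / q) + (1 + (lp_sum q M - 1) / q)"
      unfolding nrm_lp using PM q by (intro add_mono powr_inverse_le_tangent lp_sum_nonneg) auto
    also have "\<dots> = 2 + (lp_sum q P + lp_sum q M - 2) / q"
      by (simp add: diff_divide_distrib add_divide_distrib)
    also have "\<dots> \<le> 2 + (2 * C * s\<^sup>2) / q"
      using le q0 by (intro add_left_mono divide_right_mono) auto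
    finally show ?thesis
      by (simp add: P_def M_def)
  qed
  then show ?thesis
    using C(1) q0 by (intro exI[of _ "2 * C / q"]) auto
qed

subsection \<open>Property \<open>L\<^sub>p\<^sub>p\<close>\<close>

text \<open>A diagonal argument over a countable index set, used for the matrix entries of forms and
  for the coordinates of pairs of vectors.\<close>

lemma bounded_convergent_subsequence:
  fixes f :: "nat \<Rightarrow> 'a::countable \<Rightarrow> 'b::{real_normed_vector,heine_borel}"
  assumes "\<And>n x. norm (f n x) \<le> M"
  shows "\<exists>r. strict_mono (r::nat \<Rightarrow> nat) \<and> (\<forall>x. \<exists>L. (\<lambda>n. f (r n) x) \<longlonglongrightarrow> L)"
proof (rule function_convergent_subsequence[of UNIV f M])
  fix k :: "nat \<Rightarrow> nat"
  assume "strict_mono k" "\<And>x. x \<in> UNIV \<Longrightarrow> \<exists>L. (\<lambda>n. f (k n) x) \<longlonglongrightarrow> L"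
  then show ?thesis by blast
qed (use assms in auto)

lemma nrm_disjoint_le':
  assumes "x \<in> carr (lp p)" "y \<in> carr (lp p)" "\<And>n. x n = 0 \<or> y n = 0" "1 \<le> p"
    and "nrm (lp p) x \<le> 1" "nrm (lp p) y \<le> t"
  shows "nrm (lp p) (\<lambda>n. x n + y n) \<le> 1 + t powr p"
proof -
  have "nrm (lp p) (\<lambda>n. x n + y n) \<le> (1 + t powr p) powr (1 / p)"
    using assms by (intro nrm_disjoint_le) auto
  also have "\<dots> \<le> (1 + t powr p) powr 1"
    using assms by (intro powr_mono) auto
  finally show ?thesis by simp
qed

text \<open>
  Perturbing \<open>x\<close> by \<open>t u\<close>, with \<open>u\<close> far out, costs only order \<open>t powr p\<close> in norm, and perturbing \<open>y\<close>
  by \<open>s v\<close> costs order \<open>s\<^sup>2\<close> on average, whereas the form gains \<open>s t \<bar>A u v\<bar>\<close>. With \<open>s = l t\<close> and \<open>p > 2\<close>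
  this forces \<open>\<bar>A u v\<bar>\<close> to be small.
\<close>

lemma almost_attaining_tail_left:
  fixes x y :: "nat \<Rightarrow> 'k::{real_normed_field,euclidean_space}"
  assumes p: "2 < p" and q: "2 \<le> q" and e: "0 < e"
    and x: "x \<in> usphere (lp p)" and y: "y \<in> usphere (lp q)"
  shows "\<exists>N. \<exists>\<eta>>0. \<forall>A\<in>bounded_bilinear_forms (lp p) (lp q).
    form_norm (lp p) (lp q) A = 1 \<longrightarrow> 1 - \<eta> < norm (A x y) \<longrightarrow>
    (\<forall>u\<in>carr (lp p). \<forall>v\<in>carr (lp q). norm (A (tail N u) v) \<le> e * nrm (lp p) u * nrm (lp q) v)"
proof -
  have p': "0 < p" "1 \<le> p" and q': "0 < q" using p q by auto
  have xc: "x \<in> carr (lp p)" "nrm (lp p) x = 1" and yc: "y \<in> carr (lp q)" "nrm (lp q) y = 1"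
    using x y by (auto dest: usphere_lpD)
  obtain D where D: "0 \<le> D" and par: "\<forall>(y::nat \<Rightarrow> 'k)\<in>carr (lp q). \<forall>v\<in>carr (lp q). \<forall>s.
      nrm (lp q) y \<le> 1 \<longrightarrow> nrm (lp q) v \<le> 1 \<longrightarrow> 0 \<le> s \<longrightarrow> s \<le> 1 \<longrightarrow>
      nrm (lp q) (\<lambda>n. y n + of_real s * v n) + nrm (lp q) (\<lambda>n. y n - of_real s * v n) \<le> 2 + D * s\<^sup>2"
    using nrm_parallelogram[OF q, where 'k = 'k] by blast
  have par: "nrm (lp q) (\<lambda>n. y n + of_real s * v n) + nrm (lp q) (\<lambda>n. y n - of_real s * v n) \<le> 2 + D * s\<^sup>2"
    if "v \<in> carr (lp q)" "nrm (lp q) v \<le> 1" "0 \<le> s" "s \<le> 1" for v s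
    using bspec[OF bspec[OF par yc(1)] that(1)] yc(2) that by simp
  \<comment> \<open>With \<open>s = l * t\<close> the gain is
    \<open>l * t^2 * norm (A (tail N u) v)\<close>. The constants \<open>l\<close>, \<open>t\<close>
    and \<open>\<eta>\<close> keep each of the losses \<open>D * s^2\<close>,
    \<open>t powr p\<close> and \<open>2 * \<eta>\<close> below \<open>e / 4 * l * t^2\<close>, so
    the total is \<open>3 / 4\<close> of what a value \<open>e\<close> would gain.\<close>
  define l where "l = min 1 (e / (4 * (D + 1)))"
  have l: "0 < l" "l \<le> 1" "D * l \<le> e / 4"
  proof -
    show "0 < l" "l \<le> 1" using e D by (auto simp: l_def)
    have "D * l \<le> (D + 1) * (e / (4 * (D + 1)))"
      using D e by (intro mult_mono) (auto simp: l_def)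
    also have "\<dots> = e / 4"
      using D by (simp add: field_simps)
    finally show "D * l \<le> e / 4" .
  qed
  \<comment> \<open>This solves \<open>t powr (p - 2) \<le> l * e / 4\<close>, which is possible
    because \<open>p > 2\<close>.\<close>
  define t where "t = min 1 ((l * e / 4) powr (1 / (p - 2)))"
  have t: "0 < t" "t \<le> 1" "t powr p \<le> l * e / 4 * t\<^sup>2"
  proof -
    show "0 < t" "t \<le> 1" using e l by (auto simp: t_def)
    have "t powr (p - 2) \<le> ((l * e / 4) powr (1 / (p - 2))) powr (p - 2)"
      using p e l by (intro powr_mono2) (auto simp: t_def)
    also have "\<dots> = l * e / 4"
      using p e l by (simp add: powr_powr)
    finally have "t powr (p - 2) * t\<^sup>2 \<le> l * e / 4 * t\<^sup>2"
      by (intro mult_right_mono) auto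
    moreover have "t powr p = t powr (p - 2) * t\<^sup>2"
      using powr_add[of t "p - 2" 2] \<open>0 < t\<close> by simp
    ultimately show "t powr p \<le> l * e / 4 * t\<^sup>2"
      by simp
  qed
  define \<eta> where "\<eta> = l * e / 8 * t\<^sup>2"
  have \<eta>: "0 < \<eta>" using l e t by (simp add: \<eta>_def)
  \<comment> \<open>The cutoff is fixed by \<open>x\<close> and \<open>\<eta>\<close> before any
    form appears.\<close>
  have "\<forall>\<^sub>F N in sequentially. nrm (lp p) (tail N x) < \<eta>"
    using nrm_tail_tendsto[OF xc(1) p'(1)] \<eta> by (rule order_tendstoD)
  then obtain N where N: "nrm (lp p) (tail N x) < \<eta>"
    by (auto simp only: eventually_sequentially)
  have "norm (A (tail N u) v) \<le> e * nrm (lp p) u * nrm (lp q) v"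
    if A: "A \<in> bounded_bilinear_forms (lp p) (lp q)" "form_norm (lp p) (lp q) A = 1"
      and Axy: "1 - \<eta> < norm (A x y)" and uv: "u \<in> carr (lp p)" "v \<in> carr (lp q)" for A u v
  proof -
    have *: "norm (A (tail N u) v) \<le> e" if "u \<in> usphere (lp p)" "v \<in> usphere (lp q)" for u v
    proof -
      have uc: "u \<in> carr (lp p)" "nrm (lp p) u = 1" and vc: "v \<in> carr (lp q)" "nrm (lp q) v = 1"
        using that by (auto dest: usphere_lpD)
      have le: "norm (A a b) \<le> nrm (lp p) a * nrm (lp q) b" if "a \<in> carr (lp p)" "b \<in> carr (lp q)" for a b
        using form_le[OF A(1) p'(1) q' that] A(2) by simp
      \<comment> \<open>Truncating \<open>x\<close> makes it disjoint from \<open>tail N u\<close>;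
        the price is another \<open>\<eta>\<close> in the lower bound.\<close>
      define x' where "x' = initial N x"
      define u' where "u' = (\<lambda>n. of_real t * tail N u n)"
      define s where "s = l * t"
      have s: "0 < s" "s \<le> 1" using l t by (auto simp: s_def mult_le_one)
      define v' where "v' = (\<lambda>n. of_real s * v n)"
      have x': "x' \<in> carr (lp p)" "nrm (lp p) x' \<le> 1"
        using nrm_initial_le[OF xc(1) p'(1), of N] xc by (auto simp: x'_def)
      have u': "u' \<in> carr (lp p)" "nrm (lp p) u' \<le> t"
        using nrm_tail_le[OF uc(1) p'(1), of N] uc t p' by (auto simp: u'_def nrm_scale)
      have v': "v' \<in> carr (lp q)"
        using vc by (simp add: v'_def)
      have lower: "1 - 2 * \<eta> < norm (A x' y)"
      proof -
        have "A x y = A x' y + A (tail N x) y"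
          unfolding x'_def by (rule form_truncate_left[OF A(1) p'(1) xc(1) yc(1)])
        then have "norm (A x y) \<le> norm (A x' y) + norm (A (tail N x) y)"
          by (simp add: norm_triangle_ineq)
        moreover have "norm (A (tail N x) y) < \<eta>"
          using le[OF carr_tail[OF xc(1)] yc(1), of N] N yc(2) by simp
        ultimately show ?thesis
          using Axy by linarith
      qed
      obtain k where k: "norm k = 1" "2 * (norm (A x' y) + norm (A u' v')) \<le>
          norm (A (\<lambda>n. x' n + u' n) (\<lambda>n. y n + k * v' n)) +
          norm (A (\<lambda>n. x' n + - u' n) (\<lambda>n. y n + - (k * v' n)))"
        using form_sign_average[OF A(1) p'(1) q' x'(1) u'(1) yc(1) v'] by blast
      \<comment> \<open>The phase is absorbed into the direction, so that the smoothness bound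
        applies with the real parameter \<open>s\<close>.\<close>
      define w where "w = (\<lambda>n. k * v n)"
      have w: "w \<in> carr (lp q)" "nrm (lp q) w \<le> 1"
        using vc k(1) q' by (auto simp: w_def nrm_scale)
      have kw: "(\<lambda>n. y n + k * v' n) = (\<lambda>n. y n + of_real s * w n)"
        "(\<lambda>n. y n + - (k * v' n)) = (\<lambda>n. y n - of_real s * w n)"
        by (auto simp: v'_def w_def mult_ac)
      have dis: "x' n = 0 \<or> u' n = 0" for n
        by (auto simp: x'_def u'_def initial_def tail_def)
      have n1: "nrm (lp p) (\<lambda>n. x' n + u' n) \<le> 1 + t powr p"
        by (rule nrm_disjoint_le'[OF x'(1) u'(1) dis p'(2) x'(2) u'(2)])
      have n2: "nrm (lp p) (\<lambda>n. x' n + - u' n) \<le> 1 + t powr p"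
        by (rule nrm_disjoint_le') (use x' u' dis p' in auto)
      have yw: "(\<lambda>n. y n + of_real s * w n) \<in> carr (lp q)" "(\<lambda>n. y n - of_real s * w n) \<in> carr (lp q)"
        by (intro carr_add carr_diff carr_scale yc w q')+
      have xu: "(\<lambda>n. x' n + u' n) \<in> carr (lp p)" "(\<lambda>n. x' n + - u' n) \<in> carr (lp p)"
        by (intro carr_add carr_uminus x' u' p')+
      have "norm (A u' v') = t * s * norm (A (tail N u) v)"
        using form_scale_left[OF A(1) carr_tail[OF uc(1)] v', of "of_real t" N]
          form_scale_right[OF A(1) carr_tail[OF uc(1), of N] vc(1), of "of_real s"] t s
        by (simp add: u'_def v'_def norm_mult)
      then have "2 * (1 - 2 * \<eta> + t * s * norm (A (tail N u) v)) \<le> 2 * (norm (A x' y) + norm (A u' v'))"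
        using lower by simp
      also have "\<dots> \<le> norm (A (\<lambda>n. x' n + u' n) (\<lambda>n. y n + of_real s * w n)) +
          norm (A (\<lambda>n. x' n + - u' n) (\<lambda>n. y n - of_real s * w n))"
        using k(2) unfolding kw .
      also have "\<dots> \<le> (1 + t powr p) * nrm (lp q) (\<lambda>n. y n + of_real s * w n) +
          (1 + t powr p) * nrm (lp q) (\<lambda>n. y n - of_real s * w n)"
        by (intro add_mono order_trans[OF le[OF xu(1) yw(1)]] order_trans[OF le[OF xu(2) yw(2)]]
            mult_right_mono n1 n2 nrm_nonneg)
      also have "\<dots> = (1 + t powr p) *
          (nrm (lp q) (\<lambda>n. y n + of_real s * w n) + nrm (lp q) (\<lambda>n. y n - of_real s * w n))"
        by (simp add: algebra_simps)
      also have "\<dots> \<le> (1 + t powr p) * (2 + D * s\<^sup>2)"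
        using par[OF w, of s] s by (intro mult_left_mono) auto
      also have "\<dots> = 2 + 2 * t powr p + (1 + t powr p) * (D * s\<^sup>2)"
        by (simp add: algebra_simps)
      also have "\<dots> \<le> 2 + 2 * t powr p + 2 * (D * s\<^sup>2)"
        using t p D powr_le1[of p t] by (intro add_left_mono mult_right_mono) auto
      finally have "t * s * norm (A (tail N u) v) \<le> t powr p + D * s\<^sup>2 + 2 * \<eta>"
        by simp
      also have "D * s\<^sup>2 = (D * l) * (l * t\<^sup>2)"
        by (simp add: s_def power2_eq_square)
      also have "(D * l) * (l * t\<^sup>2) \<le> e / 4 * (l * t\<^sup>2)"
        using l by (intro mult_right_mono) auto
      finally have "t * s * norm (A (tail N u) v) \<le> l * e / 4 * t\<^sup>2 + e / 4 * (l * t\<^sup>2) + 2 * (l * e / 8 * t\<^sup>2)"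
        using t(3) by (simp add: \<eta>_def mult_ac)
      also have "\<dots> = 3 / 4 * (t * s * e)"
        by (simp add: s_def power2_eq_square)
      also have "\<dots> \<le> t * s * e"
        using s t e by simp
      finally show ?thesis
        using s t by simp
    qed
    show ?thesis
      by (rule form_le_of_usphere[OF form_tail_left[OF A(1) p'(1) q'] p'(1) q' * uv])
  qed
  then show ?thesis
    using \<eta> by (intro exI[of _ N] exI[of _ \<eta>]) auto
qed

text \<open>The tail estimate is applied to the form and to its flip, so each exponent in turn must
  exceed 2. \<open>N\<close>, \<open>M\<close> and \<open>\<eta>\<close> do not depend on
  \<open>A\<close>.\<close>

lemma almost_attaining_initial_approx:
  fixes x y :: "nat \<Rightarrow> 'k::{real_normed_field,euclidean_space}"
  assumes p: "2 < p" and q: "2 < q" and e: "0 < e"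
    and x: "x \<in> usphere (lp p)" and y: "y \<in> usphere (lp q)"
  shows "\<exists>N M. \<exists>\<eta>>0. \<forall>A\<in>bounded_bilinear_forms (lp p) (lp q).
    form_norm (lp p) (lp q) A = 1 \<longrightarrow> 1 - \<eta> < norm (A x y) \<longrightarrow>
    (\<forall>u\<in>carr (lp p). \<forall>v\<in>carr (lp q).
      norm (A u v - A (initial N u) (initial M v)) \<le> e * nrm (lp p) u * nrm (lp q) v)"
proof -
  have pq: "0 < p" "0 < q" "2 \<le> p" "2 \<le> q" "0 < e / 2" using p q e by auto
  obtain N \<eta> where N: "0 < \<eta>" "\<And>A u v. A \<in> bounded_bilinear_forms (lp p) (lp q) \<Longrightarrow>
      form_norm (lp p) (lp q) A = 1 \<Longrightarrow> 1 - \<eta> < norm (A x y) \<Longrightarrow> u \<in> carr (lp p) \<Longrightarrow> v \<in> carr (lp q) \<Longrightarrow>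
      norm (A (tail N u) v) \<le> e / 2 * nrm (lp p) u * nrm (lp q) v"
    using almost_attaining_tail_left[OF p pq(4,5) x y] by blast
  obtain M \<theta> where M: "0 < \<theta>" "\<And>A u v. A \<in> bounded_bilinear_forms (lp q) (lp p) \<Longrightarrow>
      form_norm (lp q) (lp p) A = 1 \<Longrightarrow> 1 - \<theta> < norm (A y x) \<Longrightarrow> u \<in> carr (lp q) \<Longrightarrow> v \<in> carr (lp p) \<Longrightarrow>
      norm (A (tail M u) v) \<le> e / 2 * nrm (lp q) u * nrm (lp p) v"
    using almost_attaining_tail_left[OF q pq(3,5) y x] by blast
  have "norm (A u v - A (initial N u) (initial M v)) \<le> e * nrm (lp p) u * nrm (lp q) v"
    if A: "A \<in> bounded_bilinear_forms (lp p) (lp q)" "form_norm (lp p) (lp q) A = 1"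
      "1 - min \<eta> \<theta> < norm (A x y)" and uv: "u \<in> carr (lp p)" "v \<in> carr (lp q)" for A u v
  proof -
    have l: "norm (A (tail N u) v) \<le> e / 2 * nrm (lp p) u * nrm (lp q) v"
      if "u \<in> carr (lp p)" "v \<in> carr (lp q)" for u v
      using A that by (intro N(2)) auto
    have r: "norm (A u (tail M v)) \<le> e / 2 * nrm (lp p) u * nrm (lp q) v"
      if "u \<in> carr (lp p)" "v \<in> carr (lp q)" for u v
    proof -
      have "form_norm (lp q) (lp p) (\<lambda>y x. A x y) = 1"
        unfolding form_norm_flip[of "lp q" "lp p" A] by (rule A(2))
      then show ?thesis
        using M(2)[OF form_flip[OF A(1)], of v u] A(3) that by (simp add: mult_ac)
    qed
    have "norm (A u v - A (initial N u) (initial M v)) \<le> 2 * (e / 2) * nrm (lp p) u * nrm (lp q) v"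
      by (rule form_initial_approx[OF A(1) pq(1,2) uv]; fact l r less_imp_le[OF pq(5)])
    then show ?thesis by simp
  qed
  then show ?thesis
    using N(1) M(1) by (intro exI[of _ N] exI[of _ M] exI[of _ "min \<eta> \<theta>"]) (intro conjI ballI impI; simp)
qed

lemma property_L_pp_lp:
  assumes p: "2 < p" and q: "2 < q"
  shows "property_L_pp (lp p :: 'k::{real_normed_field,euclidean_space} seq_space) (lp q)"
proof (rule ccontr)
  have pq: "0 < p" "0 < q" using p q by auto
  assume "\<not> ?thesis"
  then obtain e and x y :: "nat \<Rightarrow> 'k" where e: "0 < e" and x: "x \<in> usphere (lp p)" and y: "y \<in> usphere (lp q)"
    and no: "\<not> (\<exists>\<eta>>0. \<forall>A\<in>bounded_bilinear_forms (lp p) (lp q).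
      form_norm (lp p) (lp q) A = 1 \<and> norm (A x y) > 1 - \<eta> \<longrightarrow>
      (\<exists>B\<in>bounded_bilinear_forms (lp p) (lp q). form_norm (lp p) (lp q) B = 1 \<and> norm (B x y) = 1 \<and>
         form_norm (lp p) (lp q) (\<lambda>u v. B u v - A u v) < e))"
    unfolding property_L_pp_def by blast
  \<comment> \<open>Failure for every \<open>\<eta>\<close> gives forms whose values at
    \<open>(x, y)\<close> tend to 1 in norm and which stay at distance at least \<open>e\<close>
    from all admissible \<open>B\<close>; a limit of a subsequence will be such a
    \<open>B\<close>.\<close>
  define P where "P n A \<longleftrightarrow> A \<in> bounded_bilinear_forms (lp p) (lp q) \<and>
      form_norm (lp p) (lp q) A = 1 \<and> 1 - 1 / (real n + 1) < norm (A x y) \<and>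
      (\<forall>B\<in>bounded_bilinear_forms (lp p) (lp q). form_norm (lp p) (lp q) B = 1 \<longrightarrow> norm (B x y) = 1 \<longrightarrow>
         \<not> form_norm (lp p) (lp q) (\<lambda>u v. B u v - A u v) < e)" for n A
  have "\<exists>A. P n A" for n
  proof -
    have "0 < 1 / (real n + 1)" by simp
    then show ?thesis using no unfolding P_def by blast
  qed
  then obtain A where P: "\<And>n. P n (A n)"
    by metis
  have A: "A n \<in> bounded_bilinear_forms (lp p) (lp q)" "form_norm (lp p) (lp q) (A n) = 1"
    "1 - 1 / (real n + 1) < norm (A n x y)" for n
    using P[of n] unfolding P_def by blast+
  have far: "\<not> form_norm (lp p) (lp q) (\<lambda>u v. B u v - A n u v) < e"
    if "B \<in> bounded_bilinear_forms (lp p) (lp q)" "form_norm (lp p) (lp q) B = 1" "norm (B x y) = 1" for n B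
    using P[of n] that unfolding P_def by blast
  have le: "norm (A n u v) \<le> nrm (lp p) u * nrm (lp q) v" if "u \<in> carr (lp p)" "v \<in> carr (lp q)" for n u v
    using form_le[OF A(1) pq that, of n] A(2) by simp
  define f where "f n ij = A n (unit_seq (fst ij)) (unit_seq (snd ij))" for n and ij :: "nat \<times> nat"
  have bound: "norm (f n ij) \<le> 1" for n ij
    using le_form_norm[OF A(1) unit_seq_usphere unit_seq_usphere] A(2) by (simp add: f_def)
  obtain r :: "nat \<Rightarrow> nat" where r: "strict_mono r"
    and conv: "\<forall>ij. \<exists>L. (\<lambda>n. f (r n) ij) \<longlonglongrightarrow> L"
    using bounded_convergent_subsequence[of f 1] bound by blast
  have attain: "(\<lambda>n. norm (A (r n) x y)) \<longlonglongrightarrow> 1"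
  proof (rule tendsto_sandwich)
    show "(\<lambda>n. 1 - 1 / (real (r n) + 1)) \<longlonglongrightarrow> 1"
    proof -
      have "(\<lambda>n. 1 - 1 / (real n + 1)) \<longlonglongrightarrow> 1"
        by real_asymp
      from LIMSEQ_subseq_LIMSEQ[OF this r] show ?thesis
        by (simp add: o_def)
    qed
    show "\<forall>\<^sub>F n in sequentially. 1 - 1 / (real (r n) + 1) \<le> norm (A (r n) x y)"
      using A(3) by (intro always_eventually allI less_imp_le)
    show "\<forall>\<^sub>F n in sequentially. norm (A (r n) x y) \<le> 1"
      using le_form_norm[OF A(1) x y] A(2) by (intro always_eventually) simp
  qed simp
  \<comment> \<open>Entrywise convergence becomes Cauchy in the norm of forms: two truncation errors
    and the difference of two finite matrices take \<open>d / 3\<close> each. That difference is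
    compared through the entrywise limit, hence \<open>d / 6\<close> for each half.\<close>
  have cauchy: "\<exists>n0. \<forall>n\<ge>n0. \<forall>m\<ge>n0. \<forall>u\<in>carr (lp p). \<forall>v\<in>carr (lp q).
      norm (A (r n) u v - A (r m) u v) \<le> d * nrm (lp p) u * nrm (lp q) v" if d: "0 < d" for d
  proof -
    have d3: "0 < d / 3" using d by simp
    obtain N M \<eta> where \<eta>: "0 < \<eta>" and NM: "\<And>A u v. A \<in> bounded_bilinear_forms (lp p) (lp q) \<Longrightarrow>
      form_norm (lp p) (lp q) A = 1 \<Longrightarrow> 1 - \<eta> < norm (A x y) \<Longrightarrow> u \<in> carr (lp p) \<Longrightarrow> v \<in> carr (lp q) \<Longrightarrow>
      norm (A u v - A (initial N u) (initial M v)) \<le> d / 3 * nrm (lp p) u * nrm (lp q) v"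
      using almost_attaining_initial_approx[OF p q d3 x y] by blast
    define g where "g n m = (\<Sum>i<N. \<Sum>j<M. norm (f (r n) (i, j) - f (r m) (i, j)))" for n m
    obtain n1 where n1: "\<And>n. n \<ge> n1 \<Longrightarrow> 1 - \<eta> < norm (A (r n) x y)"
      using order_tendstoD[OF attain, of "1 - \<eta>"] \<eta> by (auto simp: eventually_sequentially)
    obtain L where L: "\<And>ij. (\<lambda>n. f (r n) ij) \<longlonglongrightarrow> L ij"
      using conv by metis
    have "(\<lambda>n. \<Sum>i<N. \<Sum>j<M. norm (f (r n) (i, j) - L (i, j))) \<longlonglongrightarrow> (\<Sum>i<N. \<Sum>j<M. 0)"
      by (intro tendsto_sum tendsto_norm_zero) (simp add: LIM_zero L)
    then have "\<forall>\<^sub>F n in sequentially. (\<Sum>i<N. \<Sum>j<M. norm (f (r n) (i, j) - L (i, j))) < d / 6"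
      using d by (intro order_tendstoD(2)[where y = 0]) auto
    then obtain n2 where n2: "\<And>n. n \<ge> n2 \<Longrightarrow> (\<Sum>i<N. \<Sum>j<M. norm (f (r n) (i, j) - L (i, j))) < d / 6"
      by (auto simp: eventually_sequentially)
    have g: "g n m \<le> d / 3" if "n \<ge> n2" "m \<ge> n2" for n m
    proof -
      have "g n m \<le> (\<Sum>i<N. \<Sum>j<M. norm (f (r n) (i, j) - L (i, j)) + norm (f (r m) (i, j) - L (i, j)))"
        unfolding g_def by (intro sum_mono) (metis dist_norm dist_triangle2)
      then show ?thesis
        using n2[OF that(1)] n2[OF that(2)] by (simp add: sum.distrib)
    qed
    have "norm (A (r n) u v - A (r m) u v) \<le> d * nrm (lp p) u * nrm (lp q) v"
      if nm: "n \<ge> max n1 n2" "m \<ge> max n1 n2" and uv: "u \<in> carr (lp p)" "v \<in> carr (lp q)" for n m u v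
    proof -
      define a where "a = (\<lambda>n. A (r n) (initial N u) (initial M v))"
      have "a n - a m = (\<Sum>i<N. \<Sum>j<M. u i * (v j * (f (r n) (i, j) - f (r m) (i, j))))"
        unfolding a_def form_initial[OF A(1) pq] f_def
        by (simp add: sum_subtractf[symmetric] right_diff_distrib)
      also have "norm \<dots> \<le> (\<Sum>i<N. \<Sum>j<M. nrm (lp p) u * (nrm (lp q) v * norm (f (r n) (i, j) - f (r m) (i, j))))"
        unfolding norm_mult using uv pq
        by (intro sum_norm_le order_trans[OF norm_sum] sum_mono)
          (auto simp: norm_mult intro!: mult_mono norm_le_nrm)
      also have "\<dots> = g n m * (nrm (lp p) u * nrm (lp q) v)"
        by (simp add: g_def sum_distrib_left sum_distrib_right mult_ac)
      also have "\<dots> \<le> d / 3 * (nrm (lp p) u * nrm (lp q) v)"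
        using nm by (intro mult_right_mono g) auto
      finally have 1: "norm (a n - a m) \<le> d / 3 * nrm (lp p) u * nrm (lp q) v" by simp
      have 2: "norm (A (r n) u v - a n) \<le> d / 3 * nrm (lp p) u * nrm (lp q) v" if "n \<ge> n1" for n
        unfolding a_def by (rule NM[OF A(1) A(2) n1[OF that] uv])
      have eq: "A (r n) u v - A (r m) u v = (A (r n) u v - a n) + (a n - a m) - (A (r m) u v - a m)"
        by simp
      have "norm (A (r n) u v - A (r m) u v) \<le>
          norm (A (r n) u v - a n) + norm (a n - a m) + norm (A (r m) u v - a m)"
        unfolding eq using norm_triangle_ineq[of "A (r n) u v - a n" "a n - a m"]
          norm_triangle_ineq4[of "(A (r n) u v - a n) + (a n - a m)" "A (r m) u v - a m"] by argo
      then show ?thesis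
        using 1 2[of n] 2[of m] nm by simp
    qed
    then show ?thesis by (intro exI[of _ "max n1 n2"]) blast
  qed
  have lim: "\<exists>L. (\<lambda>n. A (r n) u v) \<longlonglongrightarrow> L" if uv: "u \<in> carr (lp p)" "v \<in> carr (lp q)" for u v
  proof -
    have "Cauchy (\<lambda>n. A (r n) u v)"
    proof (rule metric_CauchyI)
      fix d :: real assume d: "0 < d"
      define c where "c = nrm (lp p) u * nrm (lp q) v"
      have c: "0 \<le> c" by (simp add: c_def)
      have "0 < d / (c + 1)" using d c by simp
      from cauchy[OF this] obtain n0 where "\<forall>n\<ge>n0. \<forall>m\<ge>n0. \<forall>u\<in>carr (lp p). \<forall>v\<in>carr (lp q).
          norm (A (r n) u v - A (r m) u v) \<le> d / (c + 1) * nrm (lp p) u * nrm (lp q) v" by blast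
      then have n0: "norm (A (r n) u v - A (r m) u v) \<le> d / (c + 1) * c"
        if "n \<ge> n0" "m \<ge> n0" for n m
        using uv that unfolding c_def by (simp add: mult.assoc)
      have "d / (c + 1) * c < d"
        using c d by (simp add: field_simps)
      then show "\<exists>M. \<forall>m\<ge>M. \<forall>n\<ge>M. dist (A (r m) u v) (A (r n) u v) < d"
        using n0 unfolding dist_norm by (meson le_less_trans)
    qed
    then show ?thesis by (simp add: Cauchy_convergent_iff convergent_def)
  qed
  \<comment> \<open>Outside the carriers \<open>lim\<close> may be arbitrary, which is harmless
    because forms are constrained only on the carriers.\<close>
  define B where "B u v = lim (\<lambda>n. A (r n) u v)" for u v
  have B: "(\<lambda>n. A (r n) u v) \<longlonglongrightarrow> B u v" if "u \<in> carr (lp p)" "v \<in> carr (lp q)" for u v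
    using lim[OF that] unfolding B_def by (simp add: convergent_LIMSEQ_iff[symmetric] convergent_def)
  have Bform: "B \<in> bounded_bilinear_forms (lp p) (lp q)"
  proof (rule bounded_bilinear_formsI[where C = 1])
    fix u u' v :: "nat \<Rightarrow> 'k" assume *: "u \<in> carr (lp p)" "u' \<in> carr (lp p)" "v \<in> carr (lp q)"
    have "(\<lambda>n. A (r n) (\<lambda>n. u n + u' n) v) \<longlonglongrightarrow> B u v + B u' v"
      unfolding form_add_left[OF A(1) *] by (intro tendsto_add B *)
    then show "B (\<lambda>n. u n + u' n) v = B u v + B u' v"
      using B[of "\<lambda>n. u n + u' n" v] * pq by (intro LIMSEQ_unique) auto
  next
    fix u v v' :: "nat \<Rightarrow> 'k" assume *: "u \<in> carr (lp p)" "v \<in> carr (lp q)" "v' \<in> carr (lp q)"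
    have "(\<lambda>n. A (r n) u (\<lambda>n. v n + v' n)) \<longlonglongrightarrow> B u v + B u v'"
      unfolding form_add_right[OF A(1) *] by (intro tendsto_add B *)
    then show "B u (\<lambda>n. v n + v' n) = B u v + B u v'"
      using B[of u "\<lambda>n. v n + v' n"] * pq by (intro LIMSEQ_unique) auto
  next
    fix c and u v :: "nat \<Rightarrow> 'k" assume *: "u \<in> carr (lp p)" "v \<in> carr (lp q)"
    have "(\<lambda>n. A (r n) (\<lambda>n. c * u n) v) \<longlonglongrightarrow> c * B u v"
      unfolding form_scale_left[OF A(1) *] by (intro tendsto_mult_left B *)
    then show "B (\<lambda>n. c * u n) v = c * B u v"
      using B[of "\<lambda>n. c * u n" v] * pq by (intro LIMSEQ_unique) auto
    have "(\<lambda>n. A (r n) u (\<lambda>n. c * v n)) \<longlonglongrightarrow> c * B u v"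
      unfolding form_scale_right[OF A(1) *] by (intro tendsto_mult_left B *)
    then show "B u (\<lambda>n. c * v n) = c * B u v"
      using B[of u "\<lambda>n. c * v n"] * pq by (intro LIMSEQ_unique) auto
  next
    fix u v :: "nat \<Rightarrow> 'k" assume *: "u \<in> carr (lp p)" "v \<in> carr (lp q)"
    show "norm (B u v) \<le> 1 * nrm (lp p) u * nrm (lp q) v"
      using le[OF *] by (intro LIMSEQ_le_const2[OF tendsto_norm[OF B[OF *]]]) simp
  qed
  have Bxy: "norm (B x y) = 1"
    using LIMSEQ_unique[OF attain tendsto_norm[OF B]] usphere_lpD(1)[OF x] usphere_lpD(1)[OF y] by simp
  have "norm (B u v) \<le> 1" if "u \<in> usphere (lp p)" "v \<in> usphere (lp q)" for u v
  proof (rule LIMSEQ_le_const2)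
    have uv: "u \<in> carr (lp p)" "v \<in> carr (lp q)" "nrm (lp p) u = 1" "nrm (lp q) v = 1"
      using that by (auto dest: usphere_lpD)
    show "(\<lambda>n. norm (A (r n) u v)) \<longlonglongrightarrow> norm (B u v)"
      by (intro tendsto_norm B uv)
    show "\<exists>n0. \<forall>n\<ge>n0. norm (A (r n) u v) \<le> 1"
      using le[OF uv(1,2)] uv(3,4) by simp
  qed
  then have "form_norm (lp p) (lp q) B \<le> 1"
    by (rule form_norm_le)
  then have Bnorm: "form_norm (lp p) (lp q) B = 1"
    using le_form_norm[OF Bform x y] Bxy by simp
  have "0 < e / 2" using e by simp
  from cauchy[OF this] obtain n0 where n0: "\<And>n m u v. n \<ge> n0 \<Longrightarrow> m \<ge> n0 \<Longrightarrow>
      u \<in> carr (lp p) \<Longrightarrow> v \<in> carr (lp q) \<Longrightarrow>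
      norm (A (r n) u v - A (r m) u v) \<le> e / 2 * nrm (lp p) u * nrm (lp q) v"
    by blast
  \<comment> \<open>Letting the first index of the Cauchy estimate tend to infinity bounds the
    distance to \<open>A (r n0)\<close>.\<close>
  have "form_norm (lp p) (lp q) (\<lambda>u v. B u v - A (r n0) u v) \<le> e / 2"
  proof (rule form_norm_le)
    fix u v :: "nat \<Rightarrow> 'k" assume "u \<in> usphere (lp p)" "v \<in> usphere (lp q)"
    then have uv: "u \<in> carr (lp p)" "v \<in> carr (lp q)" "nrm (lp p) u = 1" "nrm (lp q) v = 1"
      by (auto dest: usphere_lpD)
    have "(\<lambda>n. norm (A (r n) u v - A (r n0) u v)) \<longlonglongrightarrow> norm (B u v - A (r n0) u v)"
      by (intro tendsto_norm tendsto_diff tendsto_const B uv)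
    then show "norm (B u v - A (r n0) u v) \<le> e / 2"
      by (rule LIMSEQ_le_const2) (use n0[of _ n0 u v] uv in auto)
  qed
  then show False
    using far[OF Bform Bnorm Bxy, of "r n0"] e by simp
qed

subsection \<open>Coordinatewise limits of unit vectors\<close>

text \<open>Fatou's lemma for series, by way of finite partial sums. The norm may drop, since mass
  can escape to infinity: \<open>unit_seq n\<close> tends to 0 coordinatewise.\<close>

lemma coordinatewise_limit:
  fixes x :: "nat \<Rightarrow> nat \<Rightarrow> 'k::real_normed_field"
  assumes p: "0 < p" and x: "\<And>n. x n \<in> usphere (lp p)" and z: "\<And>i. (\<lambda>n. x n i) \<longlonglongrightarrow> z i"
  shows "z \<in> carr (lp p)" "nrm (lp p) z \<le> 1"
proof -
  have le: "(\<Sum>i<N. norm (z i) powr p) \<le> 1" for N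
  proof (rule LIMSEQ_le_const2)
    show "(\<lambda>n. \<Sum>i<N. norm (x n i) powr p) \<longlonglongrightarrow> (\<Sum>i<N. norm (z i) powr p)"
      using p by (intro tendsto_sum tendsto_powr' tendsto_norm z tendsto_const) auto
    show "\<exists>n0. \<forall>n\<ge>n0. (\<Sum>i<N. norm (x n i) powr p) \<le> 1"
      using lp_sum_initial_le[of "x _" p N] x p by (auto simp: lp_sum_initial usphere_lp)
  qed
  then have s: "summable (\<lambda>i. norm (z i) powr p)"
    by (intro summableI_nonneg_bounded[where x = 1]) auto
  then show "z \<in> carr (lp p)"
    by (simp add: carr_lp)
  have "lp_sum p z \<le> 1"
    unfolding lp_sum_def using s le by (rule suminf_le_const)
  then show "nrm (lp p) z \<le> 1"
    unfolding nrm_lp using p lp_sum_nonneg[OF \<open>z \<in> carr (lp p)\<close>] by (intro powr_le1) auto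
qed

lemma tail_diff: "tail N (\<lambda>n. x n - y n) = (\<lambda>n. tail N x n - tail N y n)"
  for x :: "nat \<Rightarrow> 'k::real_normed_field"
  by (auto simp: tail_def)

text \<open>The Radon-Riesz property of \<open>lp p\<close>. As all norms are 1, the mass of
  \<open>x n\<close> beyond \<open>N\<close> is 1 minus that of its head, so it converges to the
  mass of \<open>z\<close> beyond \<open>N\<close>. No mass escapes.\<close>

lemma nrm_tendsto_of_coordinatewise:
  fixes x :: "nat \<Rightarrow> nat \<Rightarrow> 'k::real_normed_field"
  assumes p: "0 < p" and x: "\<And>n. x n \<in> usphere (lp p)" and z: "\<And>i. (\<lambda>n. x n i) \<longlonglongrightarrow> z i"
    and zs: "z \<in> usphere (lp p)"
  shows "(\<lambda>n. nrm (lp p) (\<lambda>i. x n i - z i)) \<longlonglongrightarrow> 0"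
proof (rule nrm_tendsto_0[OF _ _ p])
  have xc: "x n \<in> carr (lp p)" "lp_sum p (x n) = 1" for n
    using x p by (auto simp: usphere_lp)
  have zc: "z \<in> carr (lp p)" "lp_sum p z = 1"
    using zs p by (auto simp: usphere_lp)
  show diff: "(\<lambda>i. x n i - z i) \<in> carr (lp p)" for n
    by (intro carr_diff xc zc p)
  show "(\<lambda>n. lp_sum p (\<lambda>i. x n i - z i)) \<longlonglongrightarrow> 0"
  proof (rule LIMSEQ_I)
    fix d :: real assume d: "0 < d"
    have "\<forall>\<^sub>F N in sequentially. lp_sum p (tail N z) < d / (2 * 2 powr p)"
      using lp_sum_tail_tendsto[OF zc(1)] d by (intro order_tendstoD(2)[where y = 0]) auto
    then obtain N where N: "lp_sum p (tail N z) < d / (2 * 2 powr p)"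
      by (auto simp only: eventually_sequentially)
    define t where "t = lp_sum p (tail N z)"
    \<comment> \<open>An upper bound built from finitely many coordinates only, so its limit can be
      taken termwise.\<close>
    define U where "U n = (\<Sum>i<N. norm (x n i - z i) powr p) +
        2 powr p * (1 - (\<Sum>i<N. norm (x n i) powr p) + t)" for n
    have le: "lp_sum p (\<lambda>i. x n i - z i) \<le> U n" for n
    proof -
      have "lp_sum p (\<lambda>i. x n i - z i) =
          lp_sum p (initial N (\<lambda>i. x n i - z i)) + lp_sum p (tail N (\<lambda>i. x n i - z i))"
        by (rule lp_sum_split[OF diff])
      also have "lp_sum p (tail N (\<lambda>i. x n i - z i)) \<le> 2 powr p * (lp_sum p (tail N (x n)) + t)"
        unfolding tail_diff t_def by (intro lp_sum_diff_le carr_tail xc zc p)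
      also have "lp_sum p (tail N (x n)) = 1 - (\<Sum>i<N. norm (x n i) powr p)"
        using lp_sum_split[OF xc(1), of n N] xc(2) by (simp add: lp_sum_initial)
      finally show ?thesis
        by (simp add: U_def lp_sum_initial)
    qed
    have 1: "(\<lambda>n. norm (x n i - z i) powr p) \<longlonglongrightarrow> 0" for i
      using p z by (intro tendsto_zero_powrI[where b = p] tendsto_norm_zero) (auto intro: LIM_zero)
    have 2: "(\<lambda>n. norm (x n i) powr p) \<longlonglongrightarrow> norm (z i) powr p" for i
      using p by (intro tendsto_powr' tendsto_norm z tendsto_const) auto
    have "U \<longlonglongrightarrow> (\<Sum>i<N. 0) + 2 powr p * (1 - (\<Sum>i<N. norm (z i) powr p) + t)"
      unfolding U_def by (intro tendsto_add tendsto_mult tendsto_diff tendsto_sum tendsto_const 1 2)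
    also have "(\<Sum>i<N. 0) + 2 powr p * (1 - (\<Sum>i<N. norm (z i) powr p) + t) = 2 powr p * (2 * t)"
      using lp_sum_split[OF zc(1), of N] zc(2) by (simp add: lp_sum_initial t_def)
    finally have "U \<longlonglongrightarrow> 2 powr p * (2 * t)" .
    moreover have "2 powr p * (2 * t) < d"
      using N by (simp add: t_def field_simps)
    ultimately have "\<forall>\<^sub>F n in sequentially. U n < d"
      by (rule order_tendstoD)
    then obtain n0 where "\<forall>n\<ge>n0. U n < d"
      by (auto simp only: eventually_sequentially)
    then show "\<exists>n0. \<forall>n\<ge>n0. norm (lp_sum p (\<lambda>i. x n i - z i) - 0) < d"
      using le lp_sum_nonneg[OF diff] by (intro exI[of _ n0]) (auto intro: le_less_trans)
  qed
qed

text \<open>On the unit balls \<open>A\<close> is within \<open>d / 3\<close> of a form in finitely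
  many coordinates. The limits \<open>z\<close> and \<open>w\<close> are only known to lie in the
  balls, which suffices.\<close>

lemma form_tendsto_of_coordinatewise:
  fixes x y :: "nat \<Rightarrow> nat \<Rightarrow> 'k::real_normed_field"
  assumes p: "1 < p" and q: "1 < q" and pq: "1 / p + 1 / q < 1"
    and A: "A \<in> bounded_bilinear_forms (lp p) (lp q)"
    and x: "\<And>n. x n \<in> usphere (lp p)" "\<And>i. (\<lambda>n. x n i) \<longlonglongrightarrow> z i"
    and y: "\<And>n. y n \<in> usphere (lp q)" "\<And>i. (\<lambda>n. y n i) \<longlonglongrightarrow> w i"
  shows "(\<lambda>n. A (x n) (y n)) \<longlonglongrightarrow> A z w"
proof (rule LIMSEQ_I)
  fix d :: real assume d: "0 < d"
  have p': "0 < p" and q': "0 < q" and qp: "1 / q + 1 / p < 1" and d6: "0 < d / 6" using p q pq d by auto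
  obtain N where N: "\<And>x y. x \<in> carr (lp p) \<Longrightarrow> y \<in> carr (lp q) \<Longrightarrow>
      norm (A (tail N x) y) \<le> d / 6 * nrm (lp p) x * nrm (lp q) y"
    using form_tail_left_small[OF A p q pq d6] by blast
  obtain M where M: "\<And>x y. y \<in> carr (lp q) \<Longrightarrow> x \<in> carr (lp p) \<Longrightarrow>
      norm (A x (tail M y)) \<le> d / 6 * nrm (lp q) y * nrm (lp p) x"
    using form_tail_left_small[OF form_flip[OF A] q p qp d6] by blast
  have M': "norm (A x (tail M y)) \<le> d / 6 * nrm (lp p) x * nrm (lp q) y"
    if "x \<in> carr (lp p)" "y \<in> carr (lp q)" for x y
    using M[OF that(2,1)] by (simp add: mult_ac)
  have approx: "norm (A u v - A (initial N u) (initial M v)) \<le> d / 3"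
    if uv: "u \<in> carr (lp p)" "nrm (lp p) u \<le> 1" "v \<in> carr (lp q)" "nrm (lp q) v \<le> 1" for u v
  proof -
    have "norm (A u v - A (initial N u) (initial M v)) \<le> 2 * (d / 6) * nrm (lp p) u * nrm (lp q) v"
      using d by (intro form_initial_approx[OF A p' q' uv(1,3) N M']) auto
    also have "\<dots> \<le> 2 * (d / 6) * 1 * 1"
      using uv d by (intro mult_mono) auto
    finally show ?thesis by simp
  qed
  have zc: "z \<in> carr (lp p)" "nrm (lp p) z \<le> 1" and wc: "w \<in> carr (lp q)" "nrm (lp q) w \<le> 1"
    using coordinatewise_limit[OF p' x] coordinatewise_limit[OF q' y] by auto
  have "(\<lambda>n. A (initial N (x n)) (initial M (y n))) \<longlonglongrightarrow> A (initial N z) (initial M w)"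
    unfolding form_initial[OF A p' q']
    by (intro tendsto_sum tendsto_mult tendsto_const x y)
  then obtain n0 where n0: "\<And>n. n \<ge> n0 \<Longrightarrow>
      norm (A (initial N (x n)) (initial M (y n)) - A (initial N z) (initial M w)) < d / 3"
    using LIMSEQ_D[of _ _ "d / 3"] d by force
  have "norm (A (x n) (y n) - A z w) < d" if "n \<ge> n0" for n
  proof -
    define a b where "a = A (initial N (x n)) (initial M (y n))" and "b = A (initial N z) (initial M w)"
    have "norm (A (x n) (y n) - a) \<le> d / 3"
      unfolding a_def using x(1)[of n] y(1)[of n] by (intro approx) (auto dest: usphere_lpD)
    moreover have "norm (A z w - b) \<le> d / 3"
      unfolding b_def by (intro approx zc wc)
    moreover have "norm (a - b) < d / 3"
      using n0[OF that] by (simp add: a_def b_def)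
    ultimately have "dist (A (x n) (y n)) a \<le> d / 3" "dist (A z w) b \<le> d / 3" "dist a b < d / 3"
      by (simp_all add: dist_norm)
    then have "dist (A (x n) (y n)) (A z w) < d"
      using dist_triangle[of "A (x n) (y n)" "A z w" a] dist_triangle2[of a "A z w" b] by linarith
    then show ?thesis by (simp add: dist_norm)
  qed
  then show "\<exists>n0. \<forall>n\<ge>n0. norm (A (x n) (y n) - A z w) < d" by blast
qed

lemma property_L_oo_lp:
  assumes p: "1 < p" and q: "1 < q" and pq: "1 / p + 1 / q < 1"
  shows "property_L_oo (lp p :: 'k::{real_normed_field,heine_borel} seq_space) (lp q)"
proof (rule ccontr)
  have p': "0 < p" and q': "0 < q" using p q by auto
  assume "\<not> ?thesis"
  then obtain e and A :: "'k form2" where e: "0 < e" and A: "A \<in> bounded_bilinear_forms (lp p) (lp q)"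
    "form_norm (lp p) (lp q) A = 1"
    and no: "\<not> (\<exists>\<eta>>0. \<forall>x\<in>usphere (lp p). \<forall>y\<in>usphere (lp q). norm (A x y) > 1 - \<eta> \<longrightarrow>
      (\<exists>z\<in>usphere (lp p). \<exists>w\<in>usphere (lp q). norm (A z w) = 1 \<and>
         max (nrm (lp p) (\<lambda>n. x n - z n)) (nrm (lp q) (\<lambda>n. y n - w n)) < e))"
    unfolding property_L_oo_def by blast
  define P where "P n x y \<longleftrightarrow> x \<in> usphere (lp p) \<and> y \<in> usphere (lp q) \<and>
      1 - 1 / (real n + 1) < norm (A x y) \<and>
      (\<forall>z\<in>usphere (lp p). \<forall>w\<in>usphere (lp q). norm (A z w) = 1 \<longrightarrow>
         \<not> max (nrm (lp p) (\<lambda>n. x n - z n)) (nrm (lp q) (\<lambda>n. y n - w n)) < e)" for n x y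
  have "\<exists>x y. P n x y" for n
  proof -
    have "0 < 1 / (real n + 1)" by simp
    then show ?thesis using no unfolding P_def by blast
  qed
  then obtain x y where P: "\<And>n. P n (x n) (y n)"
    by metis
  have x: "x n \<in> usphere (lp p)" and y: "y n \<in> usphere (lp q)"
    and Axy: "1 - 1 / (real n + 1) < norm (A (x n) (y n))" for n
    using P[of n] unfolding P_def by blast+
  have far: "\<not> max (nrm (lp p) (\<lambda>i. x n i - z i)) (nrm (lp q) (\<lambda>i. y n i - w i)) < e"
    if "z \<in> usphere (lp p)" "w \<in> usphere (lp q)" "norm (A z w) = 1" for n z w
    using P[of n] that unfolding P_def by blast
  \<comment> \<open>The Boolean tag packs both vectors into one family, so a single subsequence
    serves both.\<close>
  define f where "f n bi = (if fst bi then x n (snd bi) else y n (snd bi))" for n and bi :: "bool \<times> nat"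
  have bound: "norm (f n bi) \<le> 1" for n bi
    using norm_le_nrm[OF usphere_lpD(1)[OF x] p', of n "snd bi"] usphere_lpD(2)[OF x, of n]
      norm_le_nrm[OF usphere_lpD(1)[OF y] q', of n "snd bi"] usphere_lpD(2)[OF y, of n]
    by (simp add: f_def)
  obtain r :: "nat \<Rightarrow> nat" where r: "strict_mono r"
    and conv: "\<forall>bi. \<exists>L. (\<lambda>n. f (r n) bi) \<longlonglongrightarrow> L"
    using bounded_convergent_subsequence[of f 1] bound by blast
  have "\<exists>z. \<forall>i. (\<lambda>n. x (r n) i) \<longlonglongrightarrow> z i"
    using conv[rule_format, of "(True, _)"] unfolding f_def by (intro choice) auto
  then obtain z where z: "\<And>i. (\<lambda>n. x (r n) i) \<longlonglongrightarrow> z i" by blast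
  have "\<exists>w. \<forall>i. (\<lambda>n. y (r n) i) \<longlonglongrightarrow> w i"
    using conv[rule_format, of "(False, _)"] unfolding f_def by (intro choice) auto
  then obtain w where w: "\<And>i. (\<lambda>n. y (r n) i) \<longlonglongrightarrow> w i" by blast
  have zc: "z \<in> carr (lp p)" "nrm (lp p) z \<le> 1" and wc: "w \<in> carr (lp q)" "nrm (lp q) w \<le> 1"
    using coordinatewise_limit[OF p' x z] coordinatewise_limit[OF q' y w] by auto
  have lim: "(\<lambda>n. A (x (r n)) (y (r n))) \<longlonglongrightarrow> A z w"
    by (rule form_tendsto_of_coordinatewise[OF p q pq A(1) x z y w])
  have "(\<lambda>n. 1 - 1 / (real n + 1)) \<longlonglongrightarrow> 1"
    by real_asymp
  from LIMSEQ_subseq_LIMSEQ[OF this r] have "(\<lambda>n. 1 - 1 / (real (r n) + 1)) \<longlonglongrightarrow> 1"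
    by (simp add: o_def)
  then have ge: "1 \<le> norm (A z w)"
    using tendsto_norm[OF lim] Axy less_imp_le by (intro LIMSEQ_le) blast+
  have le: "norm (A z w) \<le> nrm (lp p) z * nrm (lp q) w"
    using form_le[OF A(1) p' q' zc(1) wc(1)] A(2) by simp
  \<comment> \<open>Both norms are at most 1 and their product is at least 1, so neither vector has
    lost mass.\<close>
  have "nrm (lp p) z * nrm (lp q) w \<le> nrm (lp p) z * 1" "nrm (lp p) z * nrm (lp q) w \<le> 1 * nrm (lp q) w"
    by (rule mult_left_mono[OF wc(2) nrm_nonneg], rule mult_right_mono[OF zc(2) nrm_nonneg])
  then have "nrm (lp p) z = 1" "nrm (lp q) w = 1" and Azw: "norm (A z w) = 1"
    using ge le zc(2) wc(2) by auto
  then have zs: "z \<in> usphere (lp p)" and ws: "w \<in> usphere (lp q)"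
    using zc wc by (auto simp: usphere_def)
  have "\<forall>\<^sub>F n in sequentially. nrm (lp p) (\<lambda>i. x (r n) i - z i) < e"
    using nrm_tendsto_of_coordinatewise[OF p' x z zs] e by (rule order_tendstoD)
  moreover have "\<forall>\<^sub>F n in sequentially. nrm (lp q) (\<lambda>i. y (r n) i - w i) < e"
    using nrm_tendsto_of_coordinatewise[OF q' y w ws] e by (rule order_tendstoD)
  ultimately have "\<forall>\<^sub>F n in sequentially.
      max (nrm (lp p) (\<lambda>i. x (r n) i - z i)) (nrm (lp q) (\<lambda>i. y (r n) i - w i)) < e"
    by eventually_elim simp
  then obtain n where "max (nrm (lp p) (\<lambda>i. x (r n) i - z i)) (nrm (lp q) (\<lambda>i. y (r n) i - w i)) < e"
    by (auto simp only: eventually_sequentially)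
  then show False
    using far[OF zs ws Azw] by blast
qed

subsection \<open>Diagonal forms when \<open>1/p + 1/q \<ge> 1\<close>\<close>

text \<open>Hoelder's inequality with the conjugate exponent \<open>r\<close> of \<open>p\<close>.
  The hypothesis says that \<open>q \<le> r\<close>, and coordinates of a unit vector are at most 1
  in norm, so \<open>norm (v n) powr r \<le> norm (v n) powr q\<close>.\<close>

lemma lp_holder_unit:
  assumes p: "1 < p" and q: "1 < q" and pq: "p * q \<le> p + q"
    and u: "u \<in> usphere (lp p)" and v: "v \<in> usphere (lp q)"
  shows "summable (\<lambda>n. norm (u n) * norm (v n))" "(\<Sum>n. norm (u n) * norm (v n)) \<le> 1"
proof -
  have p': "0 < p" "0 < q" using p q by auto
  have uc: "summable (\<lambda>n. norm (u n) powr p)" "(\<Sum>n. norm (u n) powr p) = 1"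
    and vc: "summable (\<lambda>n. norm (v n) powr q)" "(\<Sum>n. norm (v n) powr q) = 1"
    using u v p' by (auto simp: usphere_lp carr_lp lp_sum_def)
  define r where "r = p / (p - 1)"
  have r: "1 < r" "q \<le> r" "1 / p + 1 / r = 1"
    using p pq by (auto simp: r_def field_simps)
  let ?b = "\<lambda>n. norm (u n) powr p / p + norm (v n) powr q / r"
  have le: "norm (u n) * norm (v n) \<le> ?b n" for n
  proof -
    have "norm (v n) \<le> 1"
      using norm_le_nrm[OF usphere_lpD(1)[OF v] p'(2), of n] usphere_lpD(2)[OF v] by simp
    then have "norm (v n) powr r \<le> norm (v n) powr q"
      using r by (intro powr_mono') auto
    then have "norm (v n) powr r / r \<le> norm (v n) powr q / r"
      using r by (intro divide_right_mono) auto
    then show ?thesis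
      using Youngs_inequality[of p r "norm (u n)" "norm (v n)"] p r by simp
  qed
  have b: "summable ?b" "suminf ?b = 1"
  proof -
    show "summable ?b"
      by (intro summable_add summable_divide uc vc)
    have "suminf ?b = 1 / p + 1 / r"
      using suminf_add[OF summable_divide[OF uc(1)] summable_divide[OF vc(1)], of p r]
        suminf_divide[OF uc(1), of p] suminf_divide[OF vc(1), of r] uc(2) vc(2) by simp
    then show "suminf ?b = 1" using r by simp
  qed
  show s: "summable (\<lambda>n. norm (u n) * norm (v n))"
    by (rule summable_comparison_test'[OF b(1)]) (use le in auto)
  show "(\<Sum>n. norm (u n) * norm (v n)) \<le> 1"
    using suminf_le[OF le s b(1)] b(2) by simp
qed

lemma lp_holder:
  fixes u v :: "nat \<Rightarrow> 'k::real_normed_field"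
  assumes p: "1 < p" and q: "1 < q" and pq: "p * q \<le> p + q"
    and u: "u \<in> carr (lp p)" and v: "v \<in> carr (lp q)"
  shows "summable (\<lambda>n. norm (u n) * norm (v n))"
    "(\<Sum>n. norm (u n) * norm (v n)) \<le> nrm (lp p) u * nrm (lp q) v"
proof -
  have p': "0 < p" "0 < q" using p q by auto
  have "summable (\<lambda>n. norm (u n) * norm (v n)) \<and>
    (\<Sum>n. norm (u n) * norm (v n)) \<le> nrm (lp p) u * nrm (lp q) v"
  proof (cases "nrm (lp p) u = 0 \<or> nrm (lp q) v = 0")
    case True
    then have "u = (\<lambda>n. 0) \<or> v = (\<lambda>n. 0)"
      using nrm_eq_0D[OF u p'(1)] nrm_eq_0D[OF v p'(2)] by blast
    then have "(\<lambda>n. norm (u n) * norm (v n)) = (\<lambda>n. 0)" by auto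
    then show ?thesis by (simp only:) simp
  next
    case False
    define a b where "a = nrm (lp p) u" and "b = nrm (lp q) v"
    have ab: "a > 0" "b > 0"
      using False nrm_nonneg[of p u] nrm_nonneg[of q v] unfolding a_def b_def by linarith+
    define u' v' where "u' = (\<lambda>n. inverse (of_real a) * u n)" and "v' = (\<lambda>n. inverse (of_real b) * v n)"
    have "u' \<in> usphere (lp p)" "v' \<in> usphere (lp q)"
      using u v p' ab by (auto simp: usphere_def u'_def v'_def nrm_scale norm_inverse a_def b_def)
    note h = lp_holder_unit[OF p q pq this]
    have eq: "norm (u n) * norm (v n) = a * b * (norm (u' n) * norm (v' n))" for n
    proof -
      have "norm (u' n) = inverse a * norm (u n)" "norm (v' n) = inverse b * norm (v n)"
        using ab by (auto simp: u'_def v'_def norm_mult norm_inverse)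
      then have "norm (u n) = a * norm (u' n)" "norm (v n) = b * norm (v' n)"
        using ab by auto
      then show ?thesis by (simp only: mult_ac)
    qed
    have "(\<Sum>n. norm (u n) * norm (v n)) = a * b * (\<Sum>n. norm (u' n) * norm (v' n))"
      unfolding eq by (rule suminf_mult[OF h(1)])
    also have "\<dots> \<le> a * b * 1"
      using h(2) ab by (intro mult_left_mono) auto
    finally show ?thesis
      unfolding eq using summable_mult[OF h(1)] by (simp add: a_def b_def)
  qed
  then show "summable (\<lambda>n. norm (u n) * norm (v n))"
    "(\<Sum>n. norm (u n) * norm (v n)) \<le> nrm (lp p) u * nrm (lp q) v" by auto
qed

lemma not_property_L_oo_lp:
  assumes p: "1 < p" and q: "1 < q" and pq: "p * q \<le> p + q"
  shows "\<not> property_L_oo (lp p :: 'k::{real_normed_field,banach} seq_space) (lp q)"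
proof
  assume L: "property_L_oo (lp p :: 'k seq_space) (lp q)"
  define c :: "nat \<Rightarrow> real" where "c n = 1 - 1 / (real n + 2)" for n
  have c: "0 \<le> c n" "c n < 1" for n
    by (auto simp: c_def)
  define A :: "'k form2" where "A u v = (\<Sum>n. of_real (c n) * (u n * v n))" for u v
  have na: "norm (of_real (c n) * (u n * v n)) = c n * (norm (u n) * norm (v n))" for n and u v :: "nat \<Rightarrow> 'k"
    using c by (simp add: norm_mult)
  have sn: "summable (\<lambda>n. c n * (norm (u n) * norm (v n)))"
    if "u \<in> carr (lp p)" "v \<in> carr (lp q)" for u v :: "nat \<Rightarrow> 'k"
  proof (rule summable_comparison_test'[OF lp_holder(1)[OF p q pq that]])
    fix n show "norm (c n * (norm (u n) * norm (v n))) \<le> norm (u n) * norm (v n)"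
      using c[of n] by (simp add: abs_mult mult_left_le_one_le)
  qed
  have s: "summable (\<lambda>n. of_real (c n) * (u n * v n))"
    if "u \<in> carr (lp p)" "v \<in> carr (lp q)" for u v :: "nat \<Rightarrow> 'k"
    using sn[OF that] unfolding na[symmetric] by (rule summable_norm_cancel)
  have le: "norm (A u v) \<le> (\<Sum>n. c n * (norm (u n) * norm (v n)))"
    if "u \<in> carr (lp p)" "v \<in> carr (lp q)" for u v
    using summable_norm[of "\<lambda>n. of_real (c n) * (u n * v n) :: 'k"] sn[OF that] unfolding A_def na by simp
  have le1: "(\<Sum>n. c n * (norm (u n) * norm (v n))) \<le> (\<Sum>n. norm (u n) * norm (v n))"
    if "u \<in> carr (lp p)" "v \<in> carr (lp q)" for u v :: "nat \<Rightarrow> 'k"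
    using c by (intro suminf_le sn[OF that] lp_holder(1)[OF p q pq that]) (simp add: mult_left_le_one_le less_imp_le)
  have A: "A \<in> bounded_bilinear_forms (lp p) (lp q)"
  proof (rule bounded_bilinear_formsI[where C = 1])
    fix u v :: "nat \<Rightarrow> 'k" assume uv: "u \<in> carr (lp p)" "v \<in> carr (lp q)"
    show "norm (A u v) \<le> 1 * nrm (lp p) u * nrm (lp q) v"
      using le[OF uv] le1[OF uv] lp_holder(2)[OF p q pq uv] by simp
    fix k
    show "A (\<lambda>n. k * u n) v = k * A u v" "A u (\<lambda>n. k * v n) = k * A u v"
      using suminf_mult[OF s[OF uv], of k] by (auto simp: A_def mult_ac)
  next
    fix u u' v :: "nat \<Rightarrow> 'k" assume uv: "u \<in> carr (lp p)" "u' \<in> carr (lp p)" "v \<in> carr (lp q)"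
    show "A (\<lambda>n. u n + u' n) v = A u v + A u' v"
      using suminf_add[OF s[OF uv(1,3)] s[OF uv(2,3)]] by (simp add: A_def algebra_simps)
  next
    fix u v v' :: "nat \<Rightarrow> 'k" assume uv: "u \<in> carr (lp p)" "v \<in> carr (lp q)" "v' \<in> carr (lp q)"
    show "A u (\<lambda>n. v n + v' n) = A u v + A u v'"
      using suminf_add[OF s[OF uv(1,2)] s[OF uv(1,3)]] by (simp add: A_def algebra_simps)
  qed
  have Ae: "norm (A (unit_seq n) (unit_seq n)) = c n" for n
  proof -
    have "A (unit_seq n) (unit_seq n) = (\<Sum>m\<in>{n}. of_real (c m) * (unit_seq n m * unit_seq n m))"
      unfolding A_def by (rule suminf_finite) (auto simp: unit_seq_def)
    then show ?thesis using c by (simp add: unit_seq_def)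
  qed
  have lt: "norm (A z w) < 1" if "z \<in> usphere (lp p)" "w \<in> usphere (lp q)" for z w
  proof -
    have zw: "z \<in> carr (lp p)" "w \<in> carr (lp q)"
      using that by (auto dest: usphere_lpD)
    note h = lp_holder_unit[OF p q pq that]
    show ?thesis
    \<comment> \<open>One nonzero product already loses strictly against Hoelder's bound, because
      its weight is below 1; without any, the value is 0.\<close>
    proof (cases "\<exists>m. z m * w m \<noteq> 0")
      case True
      then obtain m where m: "z m * w m \<noteq> 0" by blast
      have sd: "summable (\<lambda>n. norm (z n) * norm (w n) - c n * (norm (z n) * norm (w n)))"
        by (intro summable_diff h sn zw)
      have "0 < (\<Sum>n. norm (z n) * norm (w n) - c n * (norm (z n) * norm (w n)))"
      proof (rule suminf_pos2[OF sd, of m])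
        show "0 \<le> norm (z n) * norm (w n) - c n * (norm (z n) * norm (w n))" for n
          using c[of n] by (simp add: mult_left_le_one_le)
        have "0 < (1 - c m) * (norm (z m) * norm (w m))"
          using c[of m] m by simp
        then show "0 < norm (z m) * norm (w m) - c m * (norm (z m) * norm (w m))"
          by (simp add: algebra_simps)
      qed
      then have "(\<Sum>n. c n * (norm (z n) * norm (w n))) < (\<Sum>n. norm (z n) * norm (w n))"
        using suminf_diff[OF h(1) sn[OF zw]] by simp
      then show ?thesis using le[OF zw] h(2) by simp
    next
      case False
      then have "(\<lambda>n. of_real (c n) * (z n * w n)) = (\<lambda>n. 0)" by auto
      then have "A z w = 0" unfolding A_def by (simp only: suminf_zero)
      then show ?thesis by simp
    qed
  qed
  have norm1: "form_norm (lp p) (lp q) A = 1"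
  proof (rule antisym)
    show "form_norm (lp p) (lp q) A \<le> 1"
      by (intro form_norm_le less_imp_le lt)
    have "c n \<le> form_norm (lp p) (lp q) A" for n
      using le_form_norm[OF A unit_seq_usphere unit_seq_usphere, of n n] Ae[of n] by simp
    moreover have "c \<longlonglongrightarrow> 1"
      unfolding c_def by real_asymp
    ultimately show "1 \<le> form_norm (lp p) (lp q) A"
      by (intro LIMSEQ_le_const2) auto
  qed
  \<comment> \<open>Any positive radius would do in place of 1, since no pair attains the norm at
    all, while \<open>unit_seq n\<close> nearly does for large \<open>n\<close>.\<close>
  have "\<exists>\<eta>>0. \<forall>x\<in>usphere (lp p). \<forall>y\<in>usphere (lp q). norm (A x y) > 1 - \<eta> \<longrightarrow>
      (\<exists>z\<in>usphere (lp p). \<exists>w\<in>usphere (lp q). norm (A z w) = 1 \<and>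
         max (nrm (lp p) (\<lambda>n. x n - z n)) (nrm (lp q) (\<lambda>n. y n - w n)) < 1)"
    using L A norm1 zero_less_one unfolding property_L_oo_def by blast
  then obtain \<eta> where \<eta>: "0 < \<eta>" and imp: "\<And>x y. x \<in> usphere (lp p) \<Longrightarrow> y \<in> usphere (lp q) \<Longrightarrow>
      norm (A x y) > 1 - \<eta> \<Longrightarrow> \<exists>z\<in>usphere (lp p). \<exists>w\<in>usphere (lp q). norm (A z w) = 1"
    by blast
  obtain n where "inverse (real (Suc n)) < \<eta>"
    using reals_Archimedean[OF \<eta>] by blast
  moreover have "1 / (real n + 2) \<le> inverse (real (Suc n))"
    by (simp add: field_simps)
  ultimately have "1 - \<eta> < norm (A (unit_seq n) (unit_seq n))"
    unfolding Ae by (simp add: c_def)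
  from imp[OF unit_seq_usphere unit_seq_usphere this] show False
    using lt by force
qed

section \<open>Equivalent conditions on the exponents, and the theorem\<close>

lemma conjugate_exponent_iff:
  fixes p q q' :: real
  assumes "1 < q" "1 / q + 1 / q' = 1"
  shows "p * q > p + q \<longleftrightarrow> p > q'"
proof -
  have "q' \<noteq> 0" using assms by auto
  then have q': "q' * (q - 1) = q"
    using assms by (simp add: field_simps)
  have "p * q > p + q \<longleftrightarrow> p * (q - 1) > q' * (q - 1)"
    unfolding q' by (simp add: algebra_simps)
  then show ?thesis
    using assms(1) by simp
qed

lemma property_L_oo_lp_iff:
  assumes "1 < p" "1 < q"
  shows "property_L_oo (lp p :: 'k::{real_normed_field,heine_borel,banach} seq_space) (lp q)
    \<longleftrightarrow> p * q > p + q"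
proof -
  have "1 / p + 1 / q < 1 \<longleftrightarrow> p * q > p + q"
    using assms by (simp add: field_simps)
  then show ?thesis
    using property_L_oo_lp[OF assms, where 'k = 'k] not_property_L_oo_lp[OF assms, where 'k = 'k]
    by (cases "p * q > p + q") (simp_all add: not_less)
qed

theorem theorem2p7:
  fixes p q :: real
  shows "(2 < p \<and> 2 < q \<longrightarrow>
            property_L_pp (lp p :: real seq_space) (lp q) \<and>
            property_L_pp (lp p :: complex seq_space) (lp q)) \<and>
         (1 < p \<and> 1 < q \<longrightarrow>
            (property_L_oo (lp p :: real seq_space) (lp q) \<longleftrightarrow> p * q > p + q) \<and>
            (property_L_oo (lp p :: complex seq_space) (lp q) \<longleftrightarrow> p * q > p + q) \<and>
            (\<forall>q'. 1 / q + 1 / q' = 1 \<longrightarrow> (p * q > p + q \<longleftrightarrow> p > q')))"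
  by (intro conjI impI allI property_L_pp_lp property_L_oo_lp_iff conjugate_exponent_iff) auto

end
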